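(* Let $q=p^n$ where $p$ is a prime with $p\equiv 3\pmod 4$ and $n$ is odd, let $V=\mathbb{F}_q^3$ (column vectors), and let $A=\{sE(x)\mid s\in\mathbb{F}_q^{*2},x\in\mathbb{F}_q\}\leq GL_3(\mathbb{F}_q)$, where $E(x)=\begin{pmatrix}1&x&x^2/2\\0&1&x\\0&0&1\end{pmatrix}$ and $\mathbb{F}_q^{*2}$ is the set of nonzero squares. Let $\mathcal{DD}$ be the set of all skew Hadamard difference sets in the additive group $V$ that are unions of orbits of $A$ (acting on $V$ by left multiplication). For $D\in\mathcal{DD}$ let $\mathrm{des}(D)=\{D+h\mid h\in V\}$ be the translation design with point set $V$. Then for $D,D'\in\mathcal{DD}$, the designs $\mathrm{des}(D)$ and $\mathrm{des}(D')$ are isomorphic if and only if there exists $g\in\mathbf{N}_{\mathrm{Aut}(V)}(A)$ mapping the blocks of $\mathrm{des}(D)$ onto the blocks of $\mathrm{des}(D')$.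
   Context: $\mathrm{Aut}(V)$ denotes the group of all automorphisms of the additive group $V$, i.e. all $\mathbb{F}_p$-linear bijections of $V$ ($\cong GL_{3n}(p)$), containing $A$; $\mathbf{N}_{\mathrm{Aut}(V)}(A)$ is the normalizer of $A$ in it. Two designs on point set $V$ are isomorphic if some bijection of $V$ maps the block set of one onto the block set of the other. A subset $D$ of a finite group $H$ is a skew Hadamard difference set if every non-identity element is expressible as $d_1d_2^{-1}$ ($d_1,d_2\in D$) in exactly $\lambda$ ways for a fixed $\lambda$, $H\setminus\{1_H\}=D\cup D^{(-1)}$ and $D\cap D^{(-1)}=\emptyset$. *)

theory Defs
  imports
    "HOL-Analysis.Analysis"
    "HOL-Algebra.Group_Action"
    "HOL-Computational_Algebra.Primes"
    "HOL-Number_Theory.Cong"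
begin

definition skew_Hadamard_difference_set :: "('h, 'b) monoid_scheme \<Rightarrow> 'h set \<Rightarrow> bool" where
  "skew_Hadamard_difference_set H D \<longleftrightarrow>
     group H \<and> finite (carrier H) \<and> D \<subseteq> carrier H \<and>
     (\<exists>l. \<forall>h \<in> carrier H - {\<one>\<^bsub>H\<^esub>}.
        card {(d1, d2). d1 \<in> D \<and> d2 \<in> D \<and> h = d1 \<otimes>\<^bsub>H\<^esub> inv\<^bsub>H\<^esub> d2} = l) \<and>
     carrier H - {\<one>\<^bsub>H\<^esub>} = D \<union> set_inv\<^bsub>H\<^esub> D \<and>
     D \<inter> set_inv\<^bsub>H\<^esub> D = {}"

definition additive_group :: "('v::ab_group_add) monoid" where
  "additive_group = \<lparr>carrier = UNIV, monoid.mult = (+), one = 0\<rparr>"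

definition des :: "('v::ab_group_add) set \<Rightarrow> 'v set set" where
  "des D = {(\<lambda>d. d + h) ` D | h. h \<in> UNIV}"

text \<open>A design is given by its point set and its set of blocks.\<close>

definition maps_blocks :: "('v \<Rightarrow> 'w) \<Rightarrow> 'v set set \<Rightarrow> 'w set set \<Rightarrow> bool" where
  "maps_blocks f \<B> \<B>' \<longleftrightarrow> (\<lambda>B. f ` B) ` \<B> = \<B>'"

definition isomorphic_designs :: "'v set \<Rightarrow> 'v set set \<Rightarrow> 'w set \<Rightarrow> 'w set set \<Rightarrow> bool" where
  "isomorphic_designs X \<B> Y \<B>' \<longleftrightarrow> (\<exists>f. bij_betw f X Y \<and> maps_blocks f \<B> \<B>')"

definition E_mat :: "'a::field \<Rightarrow> 'a ^ 3 ^ 3" where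
  "E_mat x = vector [vector [1, x, x\<^sup>2 / 2],
                 vector [0, 1, x],
                 vector [0, 0, 1]]"

definition nonzero_squares :: "('a::field) set" where
  "nonzero_squares = {t\<^sup>2 | t. t \<noteq> 0}"

definition A_group :: "('a::field ^ 3 ^ 3) monoid" where
  "A_group = \<lparr>carrier = {(\<chi> i j. s * E_mat x $ i $ j) | s x. s \<in> nonzero_squares},
        monoid.mult = (**), one = mat 1\<rparr>"

text \<open>The copy of \<open>A_group\<close> inside \<open>AutoGroup additive_group\<close>: a matrix is identified with
  left multiplication by it.\<close>

definition A_maps :: "('a::field ^ 3 \<Rightarrow> 'a ^ 3) set" where
  "A_maps = (\<lambda>M. (*v) M) ` carrier A_group"

definition DD :: "('a::finite_field ^ 3) set set" where
  "DD = {D. skew_Hadamard_difference_set additive_group D \<and>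
            (\<exists>\<O> \<subseteq> orbits A_group UNIV (*v). D = \<Union>\<O>)}"

text \<open>\<open>AutoGroup\<close> and \<open>normalizer\<close> are carrier-based; over the full carrier \<open>UNIV\<close> they
  specialize to the additive bijections with composition. The library's \<open>normalizer\<close> is
  meaningful only for subsets of the carrier, hence the last lemma.\<close>

lemma group_additive_group: "group (additive_group :: ('v::ab_group_add) monoid)"
  unfolding additive_group_def
proof (rule groupI; simp add: add.assoc)
  show "\<And>x::'v. \<exists>y. y + x = 0" by (metis ab_left_minus)
qed

lemma carrier_AutoGroup_additive: "carrier (AutoGroup (additive_group :: ('v::ab_group_add) monoid))
   = {f. bij f \<and> (\<forall>x y. f (x + y) = f x + f y)}"
  by (auto simp: AutoGroup_def BijGroup_def auto_def hom_def Bij_def additive_group_def)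

lemma mult_AutoGroup_additive: "g \<in> carrier (AutoGroup (additive_group :: ('v::ab_group_add) monoid)) \<Longrightarrow> 
   f \<in> carrier (AutoGroup additive_group) \<Longrightarrow> g \<otimes>\<^bsub>AutoGroup additive_group\<^esub> f = g \<circ> f"
  unfolding carrier_AutoGroup_additive
  by (auto simp: AutoGroup_def BijGroup_def auto_def hom_def Bij_def additive_group_def compose_def)

lemma one_AutoGroup_additive: "\<one>\<^bsub>AutoGroup (additive_group :: ('v::ab_group_add) monoid)\<^esub> = id"
  by (auto simp: AutoGroup_def BijGroup_def additive_group_def)

lemma inv_AutoGroup_additive: assumes g: "g \<in> carrier (AutoGroup (additive_group :: ('v::ab_group_add) monoid))"
  shows "inv\<^bsub>AutoGroup additive_group\<^esub> g = inv_into UNIV g"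
proof -
  let ?G = "AutoGroup (additive_group :: 'v monoid)"
  interpret group ?G by (rule group.AutoGroup[OF group_additive_group])
  have "inv\<^bsub>?G\<^esub> g \<in> carrier ?G" using g by simp
  then have "g \<circ> inv\<^bsub>?G\<^esub> g = id" using r_inv[OF g] mult_AutoGroup_additive g one_AutoGroup_additive by metis
  moreover have "bij g" using g carrier_AutoGroup_additive by blast
  ultimately show ?thesis by (metis inv_unique_comp bij_betw_def inv_o_cancel comp_assoc id_comp comp_id)
qed

lemma normalizer_AutoGroup_additive:
  assumes "H \<subseteq> carrier (AutoGroup (additive_group :: ('v::ab_group_add) monoid))"
  shows "normalizer (AutoGroup additive_group) H =
    {g. bij g \<and> (\<forall>x y. g (x + y) = g x + g y) \<and> (\<lambda>a. g \<circ> a \<circ> inv_into UNIV g) ` H = H}"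
proof -
  let ?G = "AutoGroup (additive_group :: 'v monoid)"
  interpret group ?G by (rule group.AutoGroup[OF group_additive_group])
  have "g <#\<^bsub>?G\<^esub> H #>\<^bsub>?G\<^esub> (inv\<^bsub>?G\<^esub> g) = (\<lambda>a. g \<circ> a \<circ> inv_into UNIV g) ` H"
    if g: "g \<in> carrier ?G" for g
  proof -
    have "g \<otimes>\<^bsub>?G\<^esub> a \<otimes>\<^bsub>?G\<^esub> inv\<^bsub>?G\<^esub> g = g \<circ> a \<circ> inv_into UNIV g" if "a \<in> H" for a
    proof -
      have a: "a \<in> carrier ?G" using that assms by blast
      show ?thesis using g a by (metis m_closed mult_AutoGroup_additive inv_AutoGroup_additive inv_closed)
    qed
    then show ?thesis by (auto simp: l_coset_def r_coset_def image_iff)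
  qed
  then show ?thesis using assms unfolding normalizer_def stabilizer_def
    using carrier_AutoGroup_additive[where 'v='v] by (auto)
qed

lemma A_maps_subset_Aut:
  "(A_maps :: ('a::finite_field ^ 3 \<Rightarrow> 'a ^ 3) set) \<subseteq> carrier (AutoGroup additive_group)"
proof
  fix f :: "'a^3 \<Rightarrow> 'a^3" assume "f \<in> A_maps"
  then obtain M where "M \<in> carrier A_group" and f0: "f = (*v) M"
    unfolding A_maps_def by (rule imageE)
  then obtain s x where "s \<in> nonzero_squares" and M: "M = (\<chi> i j. s * E_mat x $ i $ j)"
    unfolding A_group_def by auto
  then have s: "s \<noteq> 0" by (auto simp: nonzero_squares_def)
  have f: "f = (*v) (\<chi> i j. s * E_mat x $ i $ j)" unfolding f0 M ..
  have add: "f (u + v) = f u + f v" for u v by (simp add: f matrix_vector_right_distrib)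
  have "inj f"
  proof (rule injI)
    fix u v assume "f u = f v"
    then have "f (u - v) = 0" using add[of "u - v" v] by simp
    moreover define w where "w = u - v"
    ultimately have w: "f w = 0" by simp
    have "s * w $ 3 = 0" using arg_cong[OF w, of "\<lambda>z. z $ 3"]
      by (simp add: f matrix_vector_mult_def sum_3 E_mat_def)
    then have w3: "w $ 3 = 0" using s by simp
    have "s * w $ 2 = 0" using arg_cong[OF w, of "\<lambda>z. z $ 2"] w3
      by (simp add: f matrix_vector_mult_def sum_3 E_mat_def)
    then have w2: "w $ 2 = 0" using s by simp
    have "s * w $ 1 = 0" using arg_cong[OF w, of "\<lambda>z. z $ 1"] w3 w2
      by (simp add: f matrix_vector_mult_def sum_3 E_mat_def)
    then have "w = 0" using s w2 w3 by (simp add: vec_eq_iff forall_3)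
    then show "u = v" by (simp add: w_def)
  qed
  then have "bij f" by (intro bijI finite_UNIV_inj_surj finite)
  then show "f \<in> carrier (AutoGroup additive_group)" using add carrier_AutoGroup_additive by blast
qed

end

theory Submission
  imports Defs "HOL-Number_Theory.Residues"
begin

text \<open>
  Let \<open>T\<close> be the group of translations, \<open>U = {E(x)}\<close>, \<open>q = p^n\<close>, and let \<open>f\<close> be an isomorphism
  from \<open>des D\<close> to \<open>des D'\<close>. Both \<open>T\<close> and \<open>f T f\<^sup>-\<^sup>1\<close> lie in the group \<open>G\<close> of automorphisms of
  \<open>des D'\<close>, and likewise for \<open>U\<close>. If \<open>B\<close> is a \<open>p\<close>-subgroup of \<open>G\<close> such that no other
  \<open>G\<close>-conjugate of \<open>B\<close> normalizes \<open>B\<close>, then \<open>B\<close> has exactly one fixed point on its conjugates, so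
  their number is \<open>1\<close> modulo \<open>p\<close> and every \<open>p\<close>-subgroup of \<open>G\<close> normalizes some conjugate of \<open>B\<close>.
  This is applied to \<open>B = T\<close> in \<open>G\<close> and to \<open>B = U\<close> in the group of additive automorphisms, and after
  composing with elements of \<open>G\<close> the map \<open>f\<close> is additive and normalizes \<open>U\<close>.

  An additive map normalizing \<open>U\<close> is block triangular with diagonal blocks that are semilinear for one
  and the same field automorphism. If this automorphism is trivial and the map is a \<open>p\<close>-element
  preserving \<open>D\<close>, then modulo \<open>U\<close> it is a shear \<open>(a, b, c) \<mapsto> (a + k(c), b, c)\<close>; a nontrivial shear is
  excluded by counting, modulo \<open>p\<close>, the differences of elements of \<open>D\<close> with vanishing third coordinate.
  Hence a \<open>p\<close>-group of additive automorphisms of \<open>des D\<close> normalizing \<open>U\<close> has at most \<open>n\<close> cosets of its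
  intersection with \<open>U\<close>, and \<open>n\<^sup>2 < q\<close> leaves no room for an abelian group of order \<open>q\<close> or \<open>q\<^sup>3\<close>
  other than \<open>U\<close> or \<open>T\<close>. By the same analysis, \<open>f\<close> conjugates a scalar to a scalar times an element
  of \<open>U\<close>, so it normalizes \<open>A\<close>.
\<close>

section \<open>Permutation groups and conjugation\<close>

text \<open>The prefix notation for inverse functions is taken over by group inverses in HOL-Algebra.\<close>

abbreviation finv :: "('v \<Rightarrow> 'w) \<Rightarrow> 'w \<Rightarrow> 'v" where
  "finv \<equiv> inv_into UNIV"

text \<open>Groups are bare sets of maps under composition, so that subgroups and conjugates all
  live in one type.\<close>

definition perm_group :: "('v \<Rightarrow> 'v) set \<Rightarrow> bool" where
  "perm_group X \<longleftrightarrow> id \<in> X \<and> (\<forall>f\<in>X. bij f \<and> finv f \<in> X) \<and> (\<forall>f\<in>X. \<forall>g\<in>X. f \<circ> g \<in> X)"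

definition conj_set :: "('v \<Rightarrow> 'v) \<Rightarrow> ('v \<Rightarrow> 'v) set \<Rightarrow> ('v \<Rightarrow> 'v) set" where
  "conj_set g X = (\<lambda>a. g \<circ> a \<circ> finv g) ` X"

lemma perm_groupD:
  assumes "perm_group X"
  shows "id \<in> X" "f \<in> X \<Longrightarrow> bij f" "f \<in> X \<Longrightarrow> finv f \<in> X"
    "f \<in> X \<Longrightarrow> g \<in> X \<Longrightarrow> f \<circ> g \<in> X"
  using assms unfolding perm_group_def by auto

lemma perm_groupI:
  assumes "id \<in> X" "\<And>f. f \<in> X \<Longrightarrow> bij f" "\<And>f. f \<in> X \<Longrightarrow> finv f \<in> X"
    "\<And>f g. f \<in> X \<Longrightarrow> g \<in> X \<Longrightarrow> f \<circ> g \<in> X"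
  shows "perm_group X"
  using assms unfolding perm_group_def by auto

lemma bij_comp_inv:
  assumes "bij g"
  shows "g \<circ> finv g = id" "finv g \<circ> g = id"
  using assms by (simp_all add: fun_eq_iff bij_is_surj surj_f_inv_f bij_is_inj)

lemma comp_cancel:
  assumes "bij g"
  shows "g \<circ> (finv g \<circ> a) = a" "finv g \<circ> (g \<circ> b) = b"
  by (simp_all only: comp_assoc[symmetric] bij_comp_inv[OF assms] id_comp)

lemma conj_set_id [simp]: "conj_set id X = X"
  by (simp add: conj_set_def)

lemma conj_set_comp:
  assumes "bij g" "bij h"
  shows "conj_set (g \<circ> h) X = conj_set g (conj_set h X)"
  unfolding conj_set_def image_image o_inv_distrib[OF assms] comp_assoc ..

lemma conj_set_inv:
  assumes "bij g"
  shows "conj_set (finv g) (conj_set g X) = X" "conj_set g (conj_set (finv g) X) = X"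
  unfolding conj_set_comp[OF assms bij_imp_bij_inv[OF assms], symmetric]
    conj_set_comp[OF bij_imp_bij_inv[OF assms] assms, symmetric] bij_comp_inv[OF assms]
  by simp_all

lemma conj_set_mono: "X \<subseteq> Y \<Longrightarrow> conj_set g X \<subseteq> conj_set g Y"
  unfolding conj_set_def by auto

lemma inj_conj:
  assumes "bij g"
  shows "inj (\<lambda>a. g \<circ> a \<circ> finv g)"
proof (rule injI)
  fix a b assume "g \<circ> a \<circ> finv g = g \<circ> b \<circ> finv g"
  then have "finv g \<circ> (g \<circ> a \<circ> finv g) \<circ> g = finv g \<circ> (g \<circ> b \<circ> finv g) \<circ> g"
    by simp
  then show "a = b"
    by (simp add: comp_assoc comp_cancel[OF assms] bij_comp_inv[OF assms])
qed

lemma card_conj_set: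
  assumes "bij g" shows "card (conj_set g X) = card X"
  unfolding conj_set_def using inj_conj[OF assms] card_image inj_on_subset by blast

lemma conj_comp:
  assumes "bij g"
  shows "(g \<circ> a \<circ> finv g) \<circ> (g \<circ> b \<circ> finv g) = g \<circ> (a \<circ> b) \<circ> finv g"
  by (simp add: comp_assoc comp_cancel[OF assms])

lemma perm_group_conj_set:
  assumes "perm_group X" "bij g"
  shows "perm_group (conj_set g X)"
proof (rule perm_groupI)
  note X = perm_groupD[OF assms(1)]
  show "id \<in> conj_set g X"
    unfolding conj_set_def
    by (rule image_eqI[OF _ X(1)]) (simp add: bij_comp_inv[OF assms(2)])
  fix f assume "f \<in> conj_set g X"
  then obtain a where a: "a \<in> X" "f = g \<circ> a \<circ> finv g"
    unfolding conj_set_def by auto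
  show "bij f"
    unfolding a using X(2)[OF a(1)] assms(2) by (intro bij_comp bij_imp_bij_inv)
  have "finv f = g \<circ> finv a \<circ> finv g"
    unfolding a o_inv_distrib[OF bij_comp[OF X(2)[OF a(1)] assms(2)] bij_imp_bij_inv[OF assms(2)]]
    unfolding o_inv_distrib[OF assms(2) X(2)[OF a(1)]] inv_inv_eq[OF assms(2)] comp_assoc ..
  then show "finv f \<in> conj_set g X"
    unfolding conj_set_def using X(3)[OF a(1)] by auto
  fix h assume "h \<in> conj_set g X"
  then obtain b where b: "b \<in> X" "h = g \<circ> b \<circ> finv g"
    unfolding conj_set_def by auto
  show "f \<circ> h \<in> conj_set g X"
    unfolding a b conj_comp[OF assms(2)] unfolding conj_set_def using X(4)[OF a(1) b(1)] by auto
qed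

lemma conj_set_subset:
  assumes "perm_group G" "g \<in> G" "X \<subseteq> G"
  shows "conj_set g X \<subseteq> G"
proof
  fix f assume "f \<in> conj_set g X"
  then obtain a where "a \<in> G" "f = g \<circ> a \<circ> finv g"
    unfolding conj_set_def using assms(3) by auto
  then show "f \<in> G"
    using perm_groupD(3,4)[OF assms(1)] assms(2) by simp
qed

lemma conj_set_self:
  assumes "perm_group X" "g \<in> X"
  shows "conj_set g X = X"
proof
  show "conj_set g X \<subseteq> X"
    by (rule conj_set_subset[OF assms subset_refl])
  have "conj_set (finv g) X \<subseteq> X"
    by (rule conj_set_subset[OF assms(1) perm_groupD(3)[OF assms] subset_refl])
  from conj_set_mono[OF this, of g] show "X \<subseteq> conj_set g X"
    unfolding conj_set_inv(2)[OF perm_groupD(2)[OF assms]] .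
qed

section \<open>Actions of \<open>p\<close>-groups and their fixed points modulo
  \<open>p\<close>\<close>

abbreviation (input) comp_monoid :: "('v \<Rightarrow> 'v) set \<Rightarrow> ('v \<Rightarrow> 'v) monoid" where
  "comp_monoid X \<equiv> \<lparr>carrier = X, monoid.mult = (\<circ>), one = id\<rparr>"

lemma group_comp_monoid:
  assumes "perm_group X"
  shows "group (comp_monoid X)"
proof (rule groupI)
  fix x assume "x \<in> carrier (comp_monoid X)"
  then show "\<exists>y\<in>carrier (comp_monoid X). y \<otimes>\<^bsub>comp_monoid X\<^esub> x = \<one>\<^bsub>comp_monoid X\<^esub>"
    using perm_groupD[OF assms] by (auto simp: bij_comp_inv intro!: bexI[of _ "finv x"])
qed (use perm_groupD[OF assms] in \<open>simp_all add: comp_assoc\<close>)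

lemma perm_group_pow_card:
  assumes "perm_group X" "finite X" "f \<in> X"
  shows "f ^^ card X = id"
proof -
  interpret group "comp_monoid X" by (rule group_comp_monoid[OF assms(1)])
  have "f [^]\<^bsub>comp_monoid X\<^esub> k = f ^^ k" for k :: nat
    by (induction k) (simp_all add: nat_pow_def funpow_swap1 funpow_Suc_right del: funpow.simps(2))
  then show ?thesis
    using pow_order_eq_1[of f] assms by (simp add: order_def)
qed

text \<open>HOL-Algebra actions take values in \<open>BijGroup\<close>, whose elements are
  extensional; hence the restriction to \<open>\<Omega>\<close>. Bijectivity of
  \<open>\<phi> x\<close> comes from the action of the inverse of \<open>x\<close>.\<close>

lemma group_action_ofI:
  assumes X: "perm_group X"
    and closed: "\<And>x y. x \<in> X \<Longrightarrow> y \<in> \<Omega> \<Longrightarrow> \<phi> x y \<in> \<Omega>"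
    and one: "\<And>y. y \<in> \<Omega> \<Longrightarrow> \<phi> id y = y"
    and comp: "\<And>a b y. a \<in> X \<Longrightarrow> b \<in> X \<Longrightarrow> y \<in> \<Omega> \<Longrightarrow> \<phi> (a \<circ> b) y = \<phi> a (\<phi> b y)"
  shows "group_action (comp_monoid X) \<Omega> (\<lambda>x. restrict (\<phi> x) \<Omega>)"
proof -
  note Xd = perm_groupD[OF X]
  have cancel: "\<phi> (finv x) (\<phi> x y) = y" "\<phi> x (\<phi> (finv x) y) = y" if "x \<in> X" "y \<in> \<Omega>" for x y
    using that comp[of "finv x" x y] comp[of x "finv x" y] one Xd
    by (simp_all add: bij_comp_inv)
  have "bij_betw (\<phi> x) \<Omega> \<Omega>" if "x \<in> X" for x
    by (rule bij_betw_byWitness[where f' = "\<phi> (finv x)"]) (use cancel closed that Xd in auto)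
  then have "restrict (\<phi> x) \<Omega> \<in> Bij \<Omega>" if "x \<in> X" for x
    using that by (auto simp: Bij_def)
  then show ?thesis
    using closed comp
    by (intro group_action.intro group_hom.intro group_hom_axioms.intro
        group_comp_monoid[OF X] group_BijGroup homI)
      (auto simp: BijGroup_def compose_def fun_eq_iff restrict_def)
qed

text \<open>By the orbit-stabilizer theorem every orbit has size a power of \<open>p\<close>, so
  only the one-point orbits count modulo \<open>p\<close>.\<close>

lemma p_group_fixed_points:
  assumes X: "perm_group X" "card X = p ^ k" "prime p" and "finite \<Omega>"
    and closed: "\<And>x y. x \<in> X \<Longrightarrow> y \<in> \<Omega> \<Longrightarrow> \<phi> x y \<in> \<Omega>"
    and one: "\<And>y. y \<in> \<Omega> \<Longrightarrow> \<phi> id y = y"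
    and comp: "\<And>a b y. a \<in> X \<Longrightarrow> b \<in> X \<Longrightarrow> y \<in> \<Omega> \<Longrightarrow> \<phi> (a \<circ> b) y = \<phi> a (\<phi> b y)"
  shows "[card \<Omega> = card {y \<in> \<Omega>. \<forall>x\<in>X. \<phi> x y = y}] (mod p)"
proof -
  define H where "H = comp_monoid X"
  define \<psi> where "\<psi> = (\<lambda>x. restrict (\<phi> x) \<Omega>)"
  interpret A: group_action H \<Omega> \<psi>
    unfolding H_def \<psi>_def by (rule group_action_ofI[OF X(1) closed one comp])
  have orb: "orbit H \<psi> y = (\<lambda>x. \<phi> x y) ` X" if "y \<in> \<Omega>" for y
    using that by (auto simp: orbit_def H_def \<psi>_def)
  define F where "F = {y \<in> \<Omega>. \<forall>x\<in>X. \<phi> x y = y}"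
  define O1 where "O1 = {Z \<in> orbits H \<Omega> \<psi>. card Z = 1}"
  define O2 where "O2 = {Z \<in> orbits H \<Omega> \<psi>. card Z \<noteq> 1}"
  have sub: "Z \<subseteq> \<Omega>" "finite Z" if "Z \<in> orbits H \<Omega> \<psi>" for Z
    using A.orbits_coverture that \<open>finite \<Omega>\<close> by (auto intro: finite_subset)
  have fin: "finite (orbits H \<Omega> \<psi>)"
    by (rule finite_subset[of _ "Pow \<Omega>"]) (use sub \<open>finite \<Omega>\<close> in auto)
  have "card \<Omega> = (\<Sum>Z\<in>orbits H \<Omega> \<psi>. card Z)"
    using A.disjoint_sum[OF \<open>finite \<Omega>\<close>, of "\<lambda>_. 1 :: nat"] by simp
  also have "\<dots> = (\<Sum>Z\<in>O1. card Z) + (\<Sum>Z\<in>O2. card Z)"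
    by (subst sum.union_disjoint[symmetric])
      (use fin in \<open>auto simp: O1_def O2_def intro!: sum.cong\<close>)
  also have "(\<Sum>Z\<in>O1. card Z) = card O1"
    by (simp add: O1_def)
  also have "card O1 = card F"
  proof (rule bij_betw_same_card[symmetric], rule bij_betw_imageI)
    show "inj_on (\<lambda>y. {y}) F" by (auto simp: inj_on_def)
    show "(\<lambda>y. {y}) ` F = O1"
    proof (intro equalityI subsetI)
      fix Z assume "Z \<in> (\<lambda>y. {y}) ` F"
      then obtain y where y: "y \<in> F" "Z = {y}" by auto
      then have "orbit H \<psi> y = {y}"
        using orb[of y] perm_groupD(1)[OF X(1)] by (auto simp: F_def)
      then show "Z \<in> O1"
        using y by (auto simp: O1_def orbits_def F_def intro!: exI[of _ y])
    next
      fix Z assume "Z \<in> O1"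
      then obtain y where y: "y \<in> \<Omega>" "Z = orbit H \<psi> y" "card Z = 1"
        by (auto simp: O1_def orbits_def)
      then have "Z = {y}"
        using A.orbit_refl[OF y(1)] by (auto simp: card_1_singleton_iff)
      then have "y \<in> F"
        using y orb[of y] by (auto simp: F_def)
      then show "Z \<in> (\<lambda>y. {y}) ` F" using \<open>Z = {y}\<close> by auto
    qed
  qed
  finally have split: "card \<Omega> = card F + (\<Sum>Z\<in>O2. card Z)" .
  have "p dvd (\<Sum>Z\<in>O2. card Z)"
  proof (rule dvd_sum)
    fix Z assume "Z \<in> O2"
    then obtain y where y: "y \<in> \<Omega>" "Z = orbit H \<psi> y" "card Z \<noteq> 1"
      by (auto simp: O2_def orbits_def)
    have "card Z * card (stabilizer H \<psi> y) = p ^ k"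
      using A.orbit_stabilizer_theorem[OF y(1)] X(2) y(2) by (simp add: H_def order_def)
    then have "card Z dvd p ^ k" by (metis dvd_triv_left)
    then obtain i where "card Z = p ^ i" using X(3) by (auto simp: divides_primepow_nat)
    then show "p dvd card Z"
      using y(3) by (cases i) auto
  qed
  then show ?thesis
    unfolding F_def[symmetric] split by (auto simp: cong_def elim!: dvdE)
qed

text \<open>A Sylow-type argument on the set of conjugates of \<open>B\<close>. The hypothesis
  \<open>unique\<close> leaves \<open>B\<close> as the only conjugate fixed by \<open>B\<close>, so
  the number of conjugates is 1 modulo \<open>p\<close> and the \<open>p\<close>-group
  \<open>X\<close> fixes one as well. \<open>X\<close> acts through \<open>\<theta>\<close> so that
  a group of affine maps can act by its linear parts.\<close>

lemma p_group_normalizes_conjugate: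
  assumes G: "perm_group G" "finite G" and B: "perm_group B" "B \<subseteq> G" "card B = p ^ k" and "prime p"
    and unique: "\<And>g. g \<in> G \<Longrightarrow> (\<And>x. x \<in> conj_set g B \<Longrightarrow> conj_set x B = B) \<Longrightarrow> conj_set g B = B"
    and X: "perm_group X" "card X = p ^ l"
    and \<theta>: "\<And>x. x \<in> X \<Longrightarrow> \<theta> x \<in> G" "\<theta> id = id"
      "\<And>x y. x \<in> X \<Longrightarrow> y \<in> X \<Longrightarrow> \<theta> (x \<circ> y) = \<theta> x \<circ> \<theta> y"
  shows "\<exists>g\<in>G. \<forall>x\<in>X. conj_set (finv g \<circ> \<theta> x \<circ> g) B = B"
proof -
  note Gd = perm_groupD[OF G(1)]
  define \<Omega> where "\<Omega> = (\<lambda>g. conj_set g B) ` G"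
  have fin: "finite \<Omega>" using G(2) by (simp add: \<Omega>_def)
  have comp: "conj_set (g \<circ> h) Y = conj_set g (conj_set h Y)" if "g \<in> G" "h \<in> G" for g h Y
    by (rule conj_set_comp[OF Gd(2)[OF that(1)] Gd(2)[OF that(2)]])
  have closed: "conj_set g Y \<in> \<Omega>" if "g \<in> G" "Y \<in> \<Omega>" for g Y
  proof -
    from that(2) obtain h where h: "h \<in> G" "Y = conj_set h B" by (auto simp: \<Omega>_def)
    then have "conj_set g Y = conj_set (g \<circ> h) B" using comp[OF that(1) h(1)] by simp
    then show ?thesis unfolding \<Omega>_def using Gd(4)[OF that(1) h(1)] by simp
  qed
  have "B \<in> \<Omega>"
    unfolding \<Omega>_def by (rule image_eqI[OF _ Gd(1)]) simp
  have BinG: "b \<in> G" if "b \<in> B" for b using that B(2) by blast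
  \<comment> \<open>If \<open>B\<close> normalizes its conjugate by \<open>g\<close>, then its
    conjugate by \<open>finv g\<close> normalizes \<open>B\<close>; so \<open>unique\<close> is
    applied to \<open>finv g\<close>.\<close>
  have "{Y \<in> \<Omega>. \<forall>b\<in>B. conj_set b Y = Y} = {B}"
  proof (intro equalityI subsetI)
    fix Y assume "Y \<in> {Y \<in> \<Omega>. \<forall>b\<in>B. conj_set b Y = Y}"
    then obtain g where g: "g \<in> G" "Y = conj_set g B" and fixed: "\<And>b. b \<in> B \<Longrightarrow> conj_set b (conj_set g B) = conj_set g B"
      by (auto simp: \<Omega>_def)
    have g': "finv g \<in> G" "bij g" using Gd(2,3)[OF g(1)] by simp_all
    have "conj_set x B = B" if x: "x \<in> conj_set (finv g) B" for x
    proof -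
      obtain b where b: "b \<in> B" "x = finv g \<circ> b \<circ> g"
        using x unfolding conj_set_def inv_inv_eq[OF g'(2)] by (elim imageE)
      have "conj_set x B = conj_set (finv g) (conj_set b (conj_set g B))"
        unfolding b(2) comp[OF Gd(4)[OF g'(1) BinG[OF b(1)]] g(1)] comp[OF g'(1) BinG[OF b(1)]] ..
      also have "\<dots> = B"
        using fixed[OF b(1)] conj_set_inv(1)[OF g'(2)] by simp
      finally show ?thesis .
    qed
    then have "conj_set (finv g) B = B" using unique[OF g'(1)] by blast
    from arg_cong[OF this, of "conj_set g"] have "conj_set g B = B"
      unfolding conj_set_inv(2)[OF g'(2)] by simp
    then show "Y \<in> {B}" using g by simp
  next
    fix Y assume "Y \<in> {B}"
    then show "Y \<in> {Y \<in> \<Omega>. \<forall>b\<in>B. conj_set b Y = Y}"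
      using conj_set_self[OF B(1)] \<open>B \<in> \<Omega>\<close> by simp
  qed
  then have "[card \<Omega> = 1] (mod p)"
    using p_group_fixed_points[OF B(1,3) \<open>prime p\<close> fin, of "\<lambda>b. conj_set b"] closed comp BinG by simp
  moreover have "[card \<Omega> = card {Y \<in> \<Omega>. \<forall>x\<in>X. conj_set (\<theta> x) Y = Y}] (mod p)"
    using p_group_fixed_points[OF X \<open>prime p\<close> fin, of "\<lambda>x. conj_set (\<theta> x)"] closed comp \<theta> by simp
  ultimately have "[card {Y \<in> \<Omega>. \<forall>x\<in>X. conj_set (\<theta> x) Y = Y} = 1] (mod p)"
    by (rule cong_trans[OF cong_sym, rotated])
  then have "card {Y \<in> \<Omega>. \<forall>x\<in>X. conj_set (\<theta> x) Y = Y} \<noteq> 0"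
    using prime_gt_1_nat[OF \<open>prime p\<close>] unfolding cong_def by (metis mod_0 mod_less zero_neq_one)
  then have "{Y \<in> \<Omega>. \<forall>x\<in>X. conj_set (\<theta> x) Y = Y} \<noteq> {}"
    by (rule contrapos_nn) (simp only: card.empty)
  then obtain g where g: "g \<in> G" and fixed: "\<And>x. x \<in> X \<Longrightarrow> conj_set (\<theta> x) (conj_set g B) = conj_set g B"
    by (auto simp: \<Omega>_def)
  have "conj_set (finv g \<circ> \<theta> x \<circ> g) B = B" if "x \<in> X" for x
  proof -
    have "conj_set (finv g \<circ> \<theta> x \<circ> g) B = conj_set (finv g) (conj_set (\<theta> x) (conj_set g B))"
      unfolding comp[OF Gd(4)[OF Gd(3)[OF g] \<theta>(1)[OF that]] g] comp[OF Gd(3)[OF g] \<theta>(1)[OF that]] ..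
    then show ?thesis using fixed[OF that] conj_set_inv(1)[OF Gd(2)[OF g]] by simp
  qed
  then show ?thesis using g by blast
qed

section \<open>Finite fields of odd order\<close>

text \<open>On a finite field these are the field automorphisms, since nonzero elements have nonzero
  images.\<close>

definition field_hom :: "('a::field \<Rightarrow> 'a) \<Rightarrow> bool" where
  "field_hom \<sigma> \<longleftrightarrow> \<sigma> 1 = 1 \<and> (\<forall>x y. \<sigma> (x + y) = \<sigma> x + \<sigma> y) \<and> (\<forall>x y. \<sigma> (x * y) = \<sigma> x * \<sigma> y)"

lemma field_homD:
  assumes "field_hom \<sigma>"
  shows "\<sigma> 1 = 1" "\<sigma> (x + y) = \<sigma> x + \<sigma> y" "\<sigma> (x * y) = \<sigma> x * \<sigma> y"
    "\<sigma> 0 = 0" "\<sigma> (- x) = - \<sigma> x" "\<sigma> (x - y) = \<sigma> x - \<sigma> y" "\<sigma> (x ^ k) = \<sigma> x ^ k" "\<sigma> (of_nat k) = of_nat k"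
    "x \<noteq> 0 \<Longrightarrow> \<sigma> x \<noteq> 0" "\<sigma> (sum h A) = sum (\<sigma> \<circ> h) A"
proof -
  show 1: "\<sigma> 1 = 1" and add: "\<sigma> (x + y) = \<sigma> x + \<sigma> y" and mult: "\<sigma> (x * y) = \<sigma> x * \<sigma> y" for x y
    using assms by (simp_all add: field_hom_def)
  show 0: "\<sigma> 0 = 0" using add[of 0 0] by (metis add_0_right add_left_cancel)
  show m: "\<sigma> (- x) = - \<sigma> x" for x
    using add[of x "- x"] 0 by (simp add: eq_neg_iff_add_eq_0 add.commute)
  show "\<sigma> (x - y) = \<sigma> x - \<sigma> y"
    using add[of x "- y"] m by simp
  show "\<sigma> (x ^ k) = \<sigma> x ^ k" by (induction k) (simp_all add: 1 mult)
  show "\<sigma> (of_nat k) = of_nat k" by (induction k) (simp_all add: 0 1 add)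
  show "\<sigma> x \<noteq> 0" if "x \<noteq> 0"
    using mult[of x "inverse x"] 1 that by auto
  show "\<sigma> (sum h A) = sum (\<sigma> \<circ> h) A"
    by (induction A rule: infinite_finite_induct) (simp_all add: 0 add)
qed

lemma finite_field_primitive_element:
  "\<exists>\<gamma>::'a::finite_field. \<forall>x. x \<noteq> 0 \<longrightarrow> (\<exists>i. x = \<gamma> ^ i)"
proof -
  \<comment> \<open>The type is repackaged as a ring record, to which the cyclicity of the
    multiplicative group of a finite field applies.\<close>
  define R :: "'a ring" where "R = \<lparr>carrier = UNIV :: 'a set, monoid.mult = (*), one = 1, ring.zero = 0, add = (+)\<rparr>"
  have ex: "\<exists>y. x + y = 0" "x \<noteq> 0 \<Longrightarrow> \<exists>y. x * y = 1" for x :: 'a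
    by (rule exI[of _ "- x"], simp) (rule exI[of _ "inverse x"], simp)
  have "field R"
    unfolding R_def using ex by unfold_locales (auto simp: algebra_simps Units_def)
  then interpret field R .
  have pow: "x [^]\<^bsub>R\<^esub> i = x ^ i" for x and i :: nat
    by (induction i) (simp_all add: R_def nat_pow_def mult.commute)
  have "finite (carrier R)" by (simp add: R_def)
  then obtain \<gamma> where "carrier (mult_of R) = {\<gamma> [^]\<^bsub>R\<^esub> i | i::nat. i \<in> UNIV}"
    using finite_field_mult_group_has_gen by blast
  moreover have "carrier (mult_of R) = UNIV - {0}"
    by (simp add: R_def)
  ultimately have "UNIV - {0} = {\<gamma> ^ i | i. i \<in> UNIV}"
    by (simp only: pow)
  then show ?thesis by blast
qed

text \<open>This closes the counting arguments with field automorphisms: \<open>n\<close> bounds the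
  number of automorphisms and \<open>p ^ n\<close> is the field size. With base 2 the inequality
  fails at \<open>n = 2\<close>.\<close>

lemma n_square_less_power:
  fixes p n :: nat
  assumes "p \<ge> 3" "n \<ge> 1"
  shows "n * n < p ^ n"
proof -
  have "n * n < 3 ^ n"
    using assms(2)
  proof (induction rule: nat_induct_at_least)
    case base
    show ?case by simp
  next
    case (Suc n)
    have "n * 1 \<le> n * n"
      by (rule mult_le_mono2[OF Suc.hyps])
    moreover have "Suc n * Suc n = n * n + n * 1 + n * 1 + 1"
      by simp
    ultimately show ?case
      using Suc unfolding power_Suc by linarith
  qed
  moreover have "3 ^ n \<le> p ^ n"
    using assms(1) by (rule power_mono) simp
  ultimately show ?thesis
    by (rule less_le_trans)
qed

locale odd_finite_field =
  fixes p n :: nat and ty :: "'a::finite_field itself"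
  assumes prime_p: "prime p" and p_ge_3: "p \<ge> 3" and n_pos: "n \<ge> 1" and card_field: "CARD('a) = p ^ n"
begin

lemma CHAR_field: "CHAR('a) = p"
proof -
  have "CHAR('a) dvd p ^ n"
    using CHAR_dvd_CARD[where ?'a = 'a] unfolding card_field .
  then have "CHAR('a) dvd p"
    by (rule prime_dvd_power[OF CHAR_prime])
  then show ?thesis
    by (rule primes_dvd_imp_eq[OF CHAR_prime prime_p])
qed

lemma two_neq_0 [simp]: "(2::'a) \<noteq> 0"
proof
  assume "(2::'a) = 0"
  then have "of_nat 2 = (0::'a)" by simp
  then have "p dvd 2" unfolding of_nat_eq_0_iff_char_dvd CHAR_field .
  then show False using p_ge_3 by (auto dest: dvd_imp_le)
qed

text \<open>Raising to the power \<open>CARD('a)\<close> is the identity on the field, so its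
  multiplicative group has no nontrivial element of \<open>p\<close>-power order.\<close>

lemma power_card_power_imp_1:
  assumes "(m::'a) ^ (CARD('a) ^ k) = 1"
  shows "m = 1"
  using assms finite_field_power_card_power_eq_same[of "CARD('a) ^ k" k m] by simp

text \<open>Pigeonhole gives a nonzero polynomial of degree at most \<open>n\<close> over the prime
  field that vanishes at a primitive element. A homomorphism fixes the coefficients, so it sends
  that element to a root, and it is determined by this image.\<close>

lemma card_field_homs: "card {\<sigma>. field_hom (\<sigma> :: 'a \<Rightarrow> 'a)} \<le> n"
proof -
  obtain \<gamma> :: 'a where \<gamma>: "\<And>x. x \<noteq> 0 \<Longrightarrow> \<exists>i. x = \<gamma> ^ i"
    using finite_field_primitive_element by blast
  \<comment> \<open>The \<open>n + 1\<close> digits below \<open>p\<close> give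
    \<open>p ^ (n + 1)\<close> choices, more than there are field elements.\<close>
  define C where "C = {..n} \<rightarrow>\<^sub>E {..<p}"
  define ev where "ev = (\<lambda>c. \<Sum>i\<le>n. of_nat (c i) * \<gamma> ^ i)"
  have "card (ev ` C) \<le> CARD('a)" by (rule card_mono) auto
  also have "\<dots> < card C"
    using prime_p by (simp add: C_def card_PiE card_field prime_gt_0_nat prime_gt_1_nat[simplified])
  finally have "\<not> inj_on ev C" by (auto simp: card_image)
  then obtain c d where cd: "c \<in> C" "d \<in> C" "c \<noteq> d" "ev c = ev d"
    by (auto simp: inj_on_def)
  define P where "P = (\<Sum>i\<le>n. Polynomial.monom (of_nat (c i) - of_nat (d i) :: 'a) i)"
  have coeff: "poly.coeff P i = of_nat (c i) - of_nat (d i)" if "i \<le> n" for i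
    using that by (simp add: P_def coeff_sum)
  obtain i where i: "i \<le> n" "c i \<noteq> d i"
    using cd(1-3) unfolding C_def by (metis PiE_ext atMost_iff)
  moreover have "c i < p" "d i < p" using cd(1,2) i(1) by (auto simp: C_def PiE_def Pi_def)
  ultimately have "(of_nat (c i) :: 'a) \<noteq> of_nat (d i)"
    by (simp add: of_nat_eq_iff_cong_CHAR CHAR_field cong_def)
  then have "P \<noteq> 0" using coeff[OF i(1)] by auto
  have "degree P \<le> n"
    unfolding P_def by (intro degree_sum_le) (auto intro: order_trans[OF degree_monom_le])
  have root: "poly P (\<sigma> \<gamma>) = 0" if "field_hom \<sigma>" for \<sigma>
  proof -
    have "poly P (\<sigma> \<gamma>) = \<sigma> (ev c) - \<sigma> (ev d)"
      unfolding P_def ev_def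
      by (simp add: field_homD[OF that] poly_sum poly_monom sum_subtractf[symmetric] algebra_simps o_def)
    then show ?thesis using cd(4) by simp
  qed
  have "inj_on (\<lambda>\<sigma>. \<sigma> \<gamma>) {\<sigma>. field_hom \<sigma>}"
  proof (rule inj_onI, rule ext)
    fix \<sigma> \<tau> x assume h: "\<sigma> \<in> {\<sigma>. field_hom \<sigma>}" "\<tau> \<in> {\<sigma>. field_hom \<sigma>}" "\<sigma> \<gamma> = \<tau> \<gamma>"
    then have h': "field_hom \<sigma>" "field_hom \<tau>" by auto
    show "\<sigma> x = \<tau> x"
    proof (cases "x = 0")
      case False
      then obtain i where "x = \<gamma> ^ i" using \<gamma> by blast
      then show ?thesis using field_homD(7)[OF h'(1)] field_homD(7)[OF h'(2)] h(3) by simp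
    qed (simp add: field_homD(4)[OF h'(1)] field_homD(4)[OF h'(2)])
  qed
  then have "card {\<sigma>. field_hom (\<sigma> :: 'a \<Rightarrow> 'a)} = card ((\<lambda>\<sigma>. \<sigma> \<gamma>) ` {\<sigma>. field_hom \<sigma>})"
    by (simp add: card_image)
  also have "\<dots> \<le> card {x. poly P x = 0}"
    by (rule card_mono) (use root in \<open>auto\<close>)
  also have "\<dots> \<le> degree P" by (rule card_poly_roots_bound[OF \<open>P \<noteq> 0\<close>])
  finally show ?thesis using \<open>degree P \<le> n\<close> by simp
qed

text \<open>The fixed points form a proper subfield, over which 1 and any \<open>z\<close> outside
  it are independent.\<close>

lemma card_fixed_field:
  assumes \<sigma>: "field_hom (\<sigma> :: 'a \<Rightarrow> 'a)" "\<sigma> \<noteq> id"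
  shows "card {x. \<sigma> x = x} * card {x. \<sigma> x = x} \<le> CARD('a)"
proof -
  define K where "K = {x. \<sigma> x = x}"
  obtain z where z: "z \<notin> K" using \<sigma>(2) by (auto simp: K_def fun_eq_iff)
  have "inj_on (\<lambda>(a, b). a + b * z) (K \<times> K)"
  proof (rule inj_onI, clarify)
    fix a b c d assume K: "a \<in> K" "b \<in> K" "c \<in> K" "d \<in> K" and eq: "a + b * z = c + d * z"
    have 1: "(b - d) * z = c - a" using eq by (simp add: algebra_simps)
    have "(b - d) * \<sigma> z = c - a"
      using arg_cong[OF 1, of \<sigma>] K unfolding K_def by (simp only: mem_Collect_eq field_homD[OF \<sigma>(1)])
    then have "(b - d) * (\<sigma> z - z) = 0"
      using 1 unfolding right_diff_distrib by simp
    then have "b = d" using z by (simp add: K_def)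
    then show "a = c \<and> b = d" using eq by simp
  qed
  then have "card (K \<times> K) \<le> CARD('a)"
    by (rule card_inj_on_le) auto
  then show ?thesis by (simp add: K_def card_cartesian_product)
qed

text \<open>Over the fixed field of \<open>\<sigma>\<close> the solutions form a space of dimension
  at most one: a solution divided by a nonzero solution is fixed by \<open>\<sigma>\<close>.\<close>

lemma card_twisted_fixed_field:
  assumes \<sigma>: "field_hom (\<sigma> :: 'a \<Rightarrow> 'a)"
  shows "card {x. m * \<sigma> x = x} \<le> card {x. \<sigma> x = x}"
proof (cases "\<exists>y. y \<noteq> 0 \<and> m * \<sigma> y = y")
  case True
  then obtain y where y: "y \<noteq> 0" "m * \<sigma> y = y" by blast
  show ?thesis
  proof (rule card_inj_on_le[of "\<lambda>x. x / y"])
    show "(\<lambda>x. x / y) ` {x. m * \<sigma> x = x} \<subseteq> {x. \<sigma> x = x}"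
    proof clarify
      fix x assume x: "m * \<sigma> x = x"
      have "\<sigma> (x / y) * \<sigma> y = \<sigma> x" using y(1) by (simp flip: field_homD(3)[OF \<sigma>])
      then have "\<sigma> (x / y) * y = x" using x y(2) by (metis mult.left_commute)
      then show "\<sigma> (x / y) = x / y" using y(1) by (simp add: field_simps)
    qed
  qed (use y(1) in \<open>auto simp: inj_on_def\<close>)
next
  case False
  then have "{x. m * \<sigma> x = x} \<subseteq> {0}" by auto
  then have "{x. m * \<sigma> x = x} \<subseteq> {x. \<sigma> x = x}" using field_homD(4)[OF \<sigma>] by auto
  then show ?thesis by (intro card_mono) auto
qed

text \<open>Translations by the multiples of \<open>k\<close> form a group of order \<open>p\<close>
  that acts on \<open>X\<close> without fixed points.\<close>

lemma p_dvd_card_periodic: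
  assumes "(k::'a) \<noteq> 0" and per: "\<And>x. x \<in> X \<Longrightarrow> x + k \<in> X"
  shows "p dvd card X"
proof -
  define P where "P = (\<lambda>i x. x + of_nat i * k) ` {..<p}"
  have periodic: "x + of_nat i * k \<in> X" if "x \<in> X" for x i
  proof (induction i)
    case (Suc i)
    from per[OF this] show ?case by (simp add: algebra_simps)
  qed (simp add: that)
  have mod: "(\<lambda>x. x + of_nat i * k) = (\<lambda>x. x + of_nat (i mod p) * k)" for i
    by (metis CHAR_field of_nat_eq_iff_cong_CHAR cong_mod_right cong_refl)
  have memI: "(\<lambda>x. x + of_nat i * k) \<in> P" for i
    unfolding P_def by (subst mod) (use prime_p in \<open>auto simp: prime_gt_0_nat\<close>)
  have "perm_group P"
  proof (rule perm_groupI)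
    show "id \<in> P" using memI[of 0] by (simp add: id_def)
    fix f assume "f \<in> P"
    then obtain i where i: "i < p" "f = (\<lambda>x. x + of_nat i * k)" by (auto simp: P_def)
    show "bij f" unfolding i by (rule bij_betw_byWitness[of _ "\<lambda>x. x - of_nat i * k"]) auto
    have "of_nat (p - i) = - (of_nat i :: 'a)"
      using i(1) CHAR_field of_nat_CHAR[where ?'a = 'a] by (simp add: of_nat_diff)
    then have "finv f = (\<lambda>x. x + of_nat (p - i) * k)"
      unfolding i by (intro inv_equality) (simp_all add: algebra_simps)
    then show "finv f \<in> P" using memI by simp
    fix g assume "g \<in> P"
    then obtain j where j: "g = (\<lambda>x. x + of_nat j * k)" by (auto simp: P_def)
    have "f \<circ> g = (\<lambda>x. x + of_nat (i + j) * k)" by (auto simp: i j algebra_simps)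
    then show "f \<circ> g \<in> P" by (simp only: memI)
  qed
  moreover have "card P = p ^ 1"
  proof -
    have "inj_on (\<lambda>i x. x + of_nat i * k) {..<p}"
      using assms(1) by (auto simp: inj_on_def fun_eq_iff of_nat_eq_iff_cong_CHAR CHAR_field cong_def)
    then show ?thesis by (simp add: P_def card_image)
  qed
  ultimately have "[card X = card {y \<in> X. \<forall>x\<in>P. x y = y}] (mod p)"
    using prime_p periodic by (intro p_group_fixed_points[where k = 1]) (auto simp: P_def)
  moreover have "{y \<in> X. \<forall>x\<in>P. x y = y} = {}"
    using assms(1) by (auto intro!: bexI[OF _ memI[of 1]])
  ultimately show ?thesis by (simp add: cong_0_iff)
qed

end

section \<open>Additive maps normalizing the unipotent group\<close>

definition vec3 :: "'a \<Rightarrow> 'a \<Rightarrow> 'a \<Rightarrow> 'a::zero ^ 3" where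
  "vec3 a b c = vector [a, b, c]"

lemma vec3_nth [simp]: "vec3 a b c $ 1 = a" "vec3 a b c $ 2 = b" "vec3 a b c $ 3 = c"
  by (simp_all add: vec3_def)

lemma vec_eq_3: "v = w \<longleftrightarrow> v $ 1 = w $ 1 \<and> v $ 2 = w $ 2 \<and> v $ 3 = (w :: 'a ^ 3) $ 3"
  by (simp add: vec_eq_iff forall_3)

lemma vec3_collapse [simp]: "vec3 (v $ 1) (v $ 2) (v $ 3) = v"
  by (simp add: vec_eq_3)

text \<open>\<open>E_mat x\<close> is the exponential of \<open>x\<close> times the nilpotent shift,
  which makes \<open>unip\<close> a one-parameter group (\<open>unip_add\<close>).\<close>

definition unip :: "'a \<Rightarrow> 'a::field ^ 3 \<Rightarrow> 'a ^ 3" where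
  "unip x = (*v) (E_mat x)"

lemma unip_nth [simp]:
  "unip x v $ 1 = v $ 1 + x * v $ 2 + x\<^sup>2 / 2 * v $ 3"
  "unip x v $ 2 = v $ 2 + x * v $ 3"
  "unip x v $ 3 = v $ 3"
  by (simp_all add: unip_def E_mat_def matrix_vector_mult_def sum_3)

definition unips :: "('a::field ^ 3 \<Rightarrow> 'a ^ 3) set" where
  "unips = range unip"

lemma unipI [simp]: "unip x \<in> unips"
  by (simp add: unips_def)

definition additive :: "('v::ab_group_add \<Rightarrow> 'w::ab_group_add) \<Rightarrow> bool" where
  "additive g \<longleftrightarrow> (\<forall>x y. g (x + y) = g x + g y)"

lemma additiveD:
  assumes "additive g"
  shows "g (x + y) = g x + g y" "g 0 = 0" "g (- x) = - g x" "g (x - y) = g x - g y"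
proof -
  show add: "g (x + y) = g x + g y" for x y using assms by (simp add: additive_def)
  show 0: "g 0 = 0" using add[of 0 0] by simp
  show m: "g (- x) = - g x" for x
    using add[of x "- x"] 0 by (simp add: eq_neg_iff_add_eq_0 add.commute)
  show "g (x - y) = g x - g y" using add[of x "- y"] m by simp
qed

lemma additive_comp: "additive f \<Longrightarrow> additive g \<Longrightarrow> additive (f \<circ> g)"
  by (simp add: additive_def)

lemma additive_inv:
  assumes "bij g" "additive g"
  shows "additive (finv g)"
  unfolding additive_def
proof (intro allI)
  fix x y
  have "g (finv g x + finv g y) = g (finv g (x + y))"
    using assms by (simp add: additiveD bij_is_surj surj_f_inv_f)
  then show "finv g (x + y) = finv g x + finv g y"
    using assms(1) by (simp add: bij_is_inj inj_eq)
qed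

lemma additive_unip: "additive (unip x)"
  by (simp add: additive_def unip_def matrix_vector_right_distrib)

definition normalizes :: "('v \<Rightarrow> 'v) \<Rightarrow> ('v \<Rightarrow> 'v) set \<Rightarrow> bool" where
  "normalizes g X \<longleftrightarrow> bij g \<and> conj_set g X = X"

context odd_finite_field
begin

lemma unip_add: "unip x \<circ> unip y = unip (x + y :: 'a)"
proof
  fix v :: "'a ^ 3"
  have "(x + y)\<^sup>2 / 2 = x\<^sup>2 / 2 + y\<^sup>2 / 2 + x * y"
    using two_neq_0 by (simp add: power2_sum add_divide_distrib)
  then show "(unip x \<circ> unip y) v = unip (x + y) v"
    by (simp add: vec_eq_3) (simp add: algebra_simps)
qed

lemma unip_0: "unip (0::'a) = id"
  by (simp add: fun_eq_iff vec_eq_3)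

lemma unip_cancel [simp]: "unip (- x) (unip x v) = v" "unip x (unip (- x) v) = (v :: 'a ^ 3)"
  using fun_cong[OF unip_add[of "- x" x], of v] fun_cong[OF unip_add[of x "- x"], of v]
  by (simp_all add: unip_0)

lemma bij_unip: "bij (unip (x::'a))"
  using unip_add[of x "- x"] unip_add[of "- x" x] unip_0 by (intro o_bij[of "unip (- x)"]) simp_all

lemma inv_unip: "finv (unip (x::'a)) = unip (- x)"
  using unip_add[of x "- x"] unip_add[of "- x" x] unip_0
  by (intro inv_equality) (simp_all add: fun_eq_iff)

lemma unip_eq_iff: "unip x = unip y \<longleftrightarrow> x = (y::'a)"
proof
  assume "unip x = unip y"
  then have "unip x (vec3 0 0 1) $ 2 = unip y (vec3 0 0 1) $ 2" by simp
  then show "x = y" by simp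
qed simp

lemma perm_group_unips: "perm_group (unips :: ('a ^ 3 \<Rightarrow> 'a ^ 3) set)"
proof (rule perm_groupI)
  show "id \<in> (unips :: ('a ^ 3 \<Rightarrow> 'a ^ 3) set)" using unipI[of "0::'a"] unfolding unip_0 .
qed (auto simp: unips_def bij_unip inv_unip unip_add)

lemma card_unips: "card (unips :: ('a ^ 3 \<Rightarrow> 'a ^ 3) set) = CARD('a)"
  unfolding unips_def by (rule card_image) (simp add: inj_on_def unip_eq_iff)

text \<open>The action of \<open>g\<close> on \<open>U\<close> by conjugation: \<open>g E(x) g\<^sup>-\<^sup>1 = E(twist g x)\<close>.\<close>

definition twist :: "('a ^ 3 \<Rightarrow> 'a ^ 3) \<Rightarrow> 'a \<Rightarrow> 'a" where
  "twist g x = (THE y. g \<circ> unip x = unip y \<circ> g)"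

text \<open>The third diagonal block of \<open>g\<close>, i.e. the map induced on \<open>V / {c = 0}\<close>.\<close>

definition top_coord :: "('a ^ 3 \<Rightarrow> 'a ^ 3) \<Rightarrow> 'a \<Rightarrow> 'a" where
  "top_coord g c = g (vec3 0 0 c) $ 3"

text \<open>Normalized to send 1 to 1; it turns out to be the field automorphism attached to
  \<open>g\<close>.\<close>

definition twist_hom :: "('a ^ 3 \<Rightarrow> 'a ^ 3) \<Rightarrow> 'a \<Rightarrow> 'a" where
  "twist_hom g x = twist g x / twist g 1"

text \<open>The normalizer of \<open>U\<close> among all additive bijections, which need not be
  linear over the field.\<close>

definition norm_unips :: "('a ^ 3 \<Rightarrow> 'a ^ 3) set" where
  "norm_unips = {g. additive g \<and> normalizes g unips}"

lemma norm_unipsD: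
  assumes "g \<in> norm_unips"
  shows "additive g" "bij g" "conj_set g unips = unips"
  using assms by (auto simp: norm_unips_def normalizes_def)

lemma twist_unique:
  assumes "bij g" "g \<circ> unip x = unip y \<circ> g"
  shows "twist g x = y"
  unfolding twist_def
proof (rule the_equality[of _ y])
  show "g \<circ> unip x = unip y \<circ> g" by fact
  fix z assume "g \<circ> unip x = unip z \<circ> g"
  then have "unip z \<circ> g \<circ> finv g = unip y \<circ> g \<circ> finv g" using assms(2) by simp
  then show "z = y" unfolding comp_assoc bij_comp_inv[OF assms(1)] by (simp add: unip_eq_iff)
qed

lemma twist_comm:
  assumes "g \<in> norm_unips"
  shows "g \<circ> unip x = unip (twist g x) \<circ> g"
proof -
  have "g \<circ> unip x \<circ> finv g \<in> unips"
    using norm_unipsD(3)[OF assms] unipI unfolding conj_set_def by auto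
  then obtain y where y: "g \<circ> unip x \<circ> finv g = unip y" by (auto simp: unips_def)
  have "g \<circ> unip x = g \<circ> unip x \<circ> finv g \<circ> g"
    by (simp only: comp_assoc bij_comp_inv[OF norm_unipsD(2)[OF assms]] comp_id)
  then have "g \<circ> unip x = unip y \<circ> g" unfolding y .
  then show ?thesis using twist_unique[OF norm_unipsD(2)[OF assms]] by metis
qed

lemma twist_comm_apply:
  assumes "g \<in> norm_unips"
  shows "g (unip x v) = unip (twist g x) (g v)"
  using fun_cong[OF twist_comm[OF assms, of x], of v] by simp

lemma perm_group_norm_unips: "perm_group norm_unips"
proof (rule perm_groupI)
  show "id \<in> norm_unips" by (simp add: norm_unips_def additive_def normalizes_def)
next
  fix f assume f: "f \<in> norm_unips"
  show "bij f" by (rule norm_unipsD(2)[OF f])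
  show "finv f \<in> norm_unips"
    using additive_inv[OF norm_unipsD(2,1)[OF f]] bij_imp_bij_inv[OF norm_unipsD(2)[OF f]]
      conj_set_inv(1)[OF norm_unipsD(2)[OF f], of unips] norm_unipsD(3)[OF f]
    by (simp add: norm_unips_def normalizes_def)
next
  fix f g assume f: "f \<in> norm_unips" and g: "g \<in> norm_unips"
  show "f \<circ> g \<in> norm_unips"
    using additive_comp[OF norm_unipsD(1)[OF f] norm_unipsD(1)[OF g]] bij_comp[OF norm_unipsD(2)[OF g] norm_unipsD(2)[OF f]]
    by (simp add: norm_unips_def normalizes_def conj_set_comp[OF norm_unipsD(2)[OF f] norm_unipsD(2)[OF g]] norm_unipsD(3)[OF f] norm_unipsD(3)[OF g])
qed

lemma twist_comp:
  assumes "g \<in> norm_unips" "h \<in> norm_unips"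
  shows "twist (g \<circ> h) x = twist g (twist h x)"
proof (rule twist_unique)
  show "bij (g \<circ> h)" by (rule bij_comp[OF norm_unipsD(2)[OF assms(2)] norm_unipsD(2)[OF assms(1)]])
  show "g \<circ> h \<circ> unip x = unip (twist g (twist h x)) \<circ> (g \<circ> h)"
    by (simp add: fun_eq_iff twist_comm_apply assms)
qed

lemma twist_add:
  assumes "g \<in> norm_unips"
  shows "twist g (x + y) = twist g x + twist g y"
  by (rule twist_unique[OF norm_unipsD(2)[OF assms]])
    (simp add: fun_eq_iff twist_comm_apply[OF assms] flip: unip_add)

lemma twist_unip: "twist (unip b) x = x"
  by (rule twist_unique[OF bij_unip]) (simp add: unip_add add.commute)

lemma twist_inj:
  assumes "g \<in> norm_unips" "twist g x = twist g y"
  shows "x = y"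
proof -
  have "g \<circ> unip x = g \<circ> unip y" using twist_comm[OF assms(1)] assms(2) by simp
  then have "finv g \<circ> (g \<circ> unip x) = finv g \<circ> (g \<circ> unip y)" by simp
  then show ?thesis unfolding comp_cancel[OF norm_unipsD(2)[OF assms(1)]] by (simp add: unip_eq_iff)
qed

lemma twist_zero:
  assumes "g \<in> norm_unips"
  shows "twist g 0 = 0"
  using twist_add[OF assms, of 0 0] by (metis add_0_right add_left_cancel)

lemma twist_one_neq_0:
  assumes "g \<in> norm_unips"
  shows "twist g 1 \<noteq> 0"
  using twist_inj[OF assms, of 1 0] twist_zero[OF assms] by auto

section \<open>The invariant flag and the diagonal blocks of the normalizer of
  \<open>U\<close>\<close>

lemma unip_fixed_iff:
  assumes "(x::'a) \<noteq> 0"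
  shows "unip x v = v \<longleftrightarrow> v $ 2 = 0 \<and> v $ 3 = 0"
  using assms by (auto simp: vec_eq_3)

text \<open>These vectors form the fixed space of every nontrivial element of \<open>U\<close>, and
  \<open>g\<close> carries the fixed space of \<open>unip 1\<close> to that of
  \<open>unip (twist g 1)\<close>.\<close>

lemma norm_unips_L1:
  assumes "g \<in> norm_unips" "v $ 2 = 0" "v $ 3 = 0"
  shows "g v $ 2 = 0" "g v $ 3 = 0"
proof -
  have "unip (twist g 1) (g v) = g (unip 1 v)" using twist_comm_apply[OF assms(1)] by simp
  also have "unip 1 v = v" using assms(2,3) by (subst unip_fixed_iff) auto
  finally show "g v $ 2 = 0" "g v $ 3 = 0"
    using unip_fixed_iff[OF twist_one_neq_0[OF assms(1)]] by blast+
qed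

text \<open>\<open>g\<close> intertwines \<open>E(x) - 1\<close> with
  \<open>E(twist g x) - 1\<close>; the block computations below rest on this relation.\<close>

lemma norm_unips_diff:
  assumes "g \<in> norm_unips"
  shows "g (unip x v - v) = unip (twist g x) (g v) - g v"
  by (simp add: additiveD[OF norm_unipsD(1)[OF assms]] twist_comm_apply[OF assms])

text \<open>The next step of the flag: \<open>v $ 3 = 0\<close> holds exactly when
  \<open>unip 1 v - v\<close> lies on the fixed line.\<close>

lemma norm_unips_L2:
  assumes "g \<in> norm_unips" "v $ 3 = 0"
  shows "g v $ 3 = 0"
proof -
  have "g (unip 1 v - v) $ 2 = 0"
    by (rule norm_unips_L1[OF assms(1)]) (simp_all add: assms(2))
  then have "twist g 1 * g v $ 3 = 0" unfolding norm_unips_diff[OF assms(1)] by simp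
  then show ?thesis using twist_one_neq_0[OF assms(1)] by simp
qed

lemma norm_unips_nth_3:
  assumes "g \<in> norm_unips"
  shows "g v $ 3 = top_coord g (v $ 3)"
proof -
  have "g (v - vec3 0 0 (v $ 3)) $ 3 = 0"
    by (rule norm_unips_L2[OF assms]) simp
  then show ?thesis by (simp add: additiveD[OF norm_unipsD(1)[OF assms]] top_coord_def)
qed

lemma norm_unips_nth_2:
  assumes "g \<in> norm_unips" "v $ 3 = 0"
  shows "g v $ 2 = g (vec3 0 (v $ 2) 0) $ 2"
proof -
  have "g (v - vec3 0 (v $ 2) 0) $ 2 = 0"
    by (rule norm_unips_L1[OF assms(1)]) (simp_all add: assms(2))
  then show ?thesis by (simp add: additiveD[OF norm_unipsD(1)[OF assms(1)]])
qed

text \<open>Apply the intertwining relation to \<open>vec3 0 0 c\<close>. The left side depends only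
  on the product of \<open>x\<close> and \<open>c\<close>; this ties \<open>top_coord g\<close> to
  \<open>twist g\<close> and is the source of multiplicativity.\<close>

lemma norm_unips_block_2:
  assumes "g \<in> norm_unips"
  shows "g (vec3 0 (x * c) 0) $ 2 = twist g x * top_coord g c"
proof -
  have "g (unip x (vec3 0 0 c) - vec3 0 0 c) $ 2 = g (vec3 0 (x * c) 0) $ 2"
    by (subst norm_unips_nth_2[OF assms]) simp_all
  then show ?thesis unfolding norm_unips_diff[OF assms] by (simp add: top_coord_def)
qed

text \<open>Otherwise exchanging \<open>x\<close> and \<open>c\<close> in
  \<open>norm_unips_block_2\<close> makes \<open>top_coord g\<close> vanish identically, against
  surjectivity of \<open>g\<close>.\<close>

lemma top_coord_one_neq_0:
  assumes "g \<in> norm_unips"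
  shows "top_coord g 1 \<noteq> 0"
proof
  assume 0: "top_coord g 1 = 0"
  have "top_coord g c = 0" for c
    using norm_unips_block_2[OF assms, of 1 c] norm_unips_block_2[OF assms, of c 1] 0 twist_one_neq_0[OF assms] by simp
  moreover obtain v where "g v = vec3 0 0 1" using norm_unipsD(2)[OF assms] by (metis bij_pointE)
  ultimately show False using norm_unips_nth_3[OF assms, of v] by simp
qed

lemma top_coord_eq_twist_hom:
  assumes "g \<in> norm_unips"
  shows "top_coord g c = twist_hom g c * top_coord g 1"
  using norm_unips_block_2[OF assms, of 1 c] norm_unips_block_2[OF assms, of c 1] twist_one_neq_0[OF assms]
  by (simp add: twist_hom_def field_simps)

lemma twist_eq_twist_hom:
  assumes "g \<in> norm_unips"
  shows "twist g x = twist g 1 * twist_hom g x"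
  using twist_one_neq_0[OF assms] by (simp add: twist_hom_def)

text \<open>Compare \<open>norm_unips_block_2\<close> for the pairs \<open>(x, y)\<close> and
  \<open>(x * y, 1)\<close>, which have the same product.\<close>

lemma field_hom_twist_hom:
  assumes "g \<in> norm_unips"
  shows "field_hom (twist_hom g)"
proof -
  have "twist g (x * y) * top_coord g 1 = twist g x * (twist_hom g y * top_coord g 1)" for x y
    using norm_unips_block_2[OF assms, of x y] norm_unips_block_2[OF assms, of "x * y" 1]
    unfolding top_coord_eq_twist_hom[OF assms, of y] mult_1_right by (rule trans[OF sym, rotated])
  then have "twist g (x * y) = twist g x * twist_hom g y" for x y
    using top_coord_one_neq_0[OF assms] by (metis mult.assoc mult_right_cancel)
  then show ?thesis
    using twist_one_neq_0[OF assms] unfolding field_hom_def twist_hom_def by (simp add: twist_add[OF assms] add_divide_distrib)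
qed

text \<open>Passing to the field automorphism is thus a group homomorphism, whose kernel is
  estimated in \<open>card_le_twist_hom_kernel\<close>.\<close>

lemma twist_hom_comp:
  assumes "g \<in> norm_unips" "h \<in> norm_unips"
  shows "twist_hom (g \<circ> h) x = twist_hom g (twist_hom h x)"
proof -
  have "twist_hom (g \<circ> h) x = twist g (twist h 1 * twist_hom h x) / twist g (twist h 1)"
    unfolding twist_hom_def[of "g \<circ> h"] twist_comp[OF assms] twist_eq_twist_hom[OF assms(2), of x] ..
  also have "\<dots> = twist_hom g (twist h 1 * twist_hom h x) / twist_hom g (twist h 1)"
    using twist_one_neq_0[OF assms(1)] by (simp add: twist_eq_twist_hom[OF assms(1), of "_ * _"] twist_eq_twist_hom[OF assms(1), of "twist h 1"])
  also have "\<dots> = twist_hom g (twist_hom h x)"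
    using field_homD(9)[OF field_hom_twist_hom[OF assms(1)] twist_one_neq_0[OF assms(2)]]
    by (simp add: field_homD(3)[OF field_hom_twist_hom[OF assms(1)]])
  finally show ?thesis .
qed

definition shear :: "('a \<Rightarrow> 'a) \<Rightarrow> 'a ^ 3 \<Rightarrow> 'a ^ 3" where
  "shear k v = v + vec3 (k (v $ 3)) 0 0"

text \<open>The hypotheses make all diagonal blocks trivial and let \<open>g\<close> commute with
  \<open>U\<close>. This forces both superdiagonal entries to be multiplication by one scalar
  \<open>q0\<close>, as in \<open>E(q0)\<close>; only the corner entry stays free.\<close>

lemma norm_unips_unip_shear:
  assumes g: "g \<in> norm_unips" and twist: "\<And>x. twist g x = x" and top_coord1: "top_coord g 1 = 1"
  shows "\<exists>b k. g = unip b \<circ> shear k"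
proof -
  note ad = additiveD[OF norm_unipsD(1)[OF g]]
  have twist_hom: "twist_hom g x = x" for x by (simp add: twist_hom_def twist)
  have top_coord: "top_coord g c = c" for c using top_coord_eq_twist_hom[OF g, of c] by (simp add: twist_hom top_coord1)
  have \<beta>: "g (vec3 0 b 0) $ 2 = b" for b
    using norm_unips_block_2[OF g, of b 1] by (simp add: twist top_coord1)
  have \<rho>: "g (vec3 a 0 0) $ 1 = a" for a
  proof -
    have "unip a (vec3 0 1 0) - vec3 0 1 0 = vec3 a 0 0"
      by (simp add: vec_eq_3)
    then have "g (vec3 a 0 0) = unip a (g (vec3 0 1 0)) - g (vec3 0 1 0)"
      using norm_unips_diff[OF g, of a "vec3 0 1 0"] by (simp only: twist)
    then show ?thesis using norm_unips_L2[OF g, of "vec3 0 1 0"] by (simp add: \<beta>)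
  qed
  define q0 where "q0 = g (vec3 0 0 1) $ 2"
  have P: "g (vec3 0 (x * c) 0) $ 1 = x * g (vec3 0 0 c) $ 2" for x c
  proof -
    have "unip x (vec3 0 0 c) - vec3 0 0 c = vec3 (x\<^sup>2 / 2 * c) 0 0 + vec3 0 (x * c) 0"
      by (simp add: vec_eq_3)
    then have "g (vec3 (x\<^sup>2 / 2 * c) 0 0 + vec3 0 (x * c) 0) = unip x (g (vec3 0 0 c)) - g (vec3 0 0 c)"
      using norm_unips_diff[OF g, of x "vec3 0 0 c"] twist by metis
    then have "g (vec3 (x\<^sup>2 / 2 * c) 0 0) + g (vec3 0 (x * c) 0) = unip x (g (vec3 0 0 c)) - g (vec3 0 0 c)"
      by (simp only: ad(1))
    from arg_cong[OF this, of "\<lambda>v. v $ 1"] show ?thesis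
      using norm_unips_nth_3[OF g, of "vec3 0 0 c"] by (simp add: \<rho> top_coord)
  qed
  have P1: "g (vec3 0 b 0) $ 1 = q0 * b" for b
    using P[of b 1] by (simp add: q0_def mult.commute)
  have Q: "g (vec3 0 0 c) $ 2 = q0 * c" for c
    using P[of 1 c] P1[of c] by simp
  \<comment> \<open>\<open>unip q0\<close> accounts for the part \<open>q0^2 / 2 * c\<close> of the
    corner entry, and \<open>k\<close> is the rest.\<close>
  define k where "k c = g (vec3 0 0 c) $ 1 - q0\<^sup>2 / 2 * c" for c
  have "g v = (unip q0 \<circ> shear k) v" for v
  proof -
    have v: "v = vec3 (v $ 1) 0 0 + vec3 0 (v $ 2) 0 + vec3 0 0 (v $ 3)"
      by (simp add: vec_eq_3)
    have gv: "g v = g (vec3 (v $ 1) 0 0) + g (vec3 0 (v $ 2) 0) + g (vec3 0 0 (v $ 3))"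
      by (subst v) (simp only: ad(1))
    show ?thesis
      unfolding vec_eq_3
    proof (intro conjI)
      show "g v $ 1 = (unip q0 \<circ> shear k) v $ 1"
        unfolding gv by (simp add: \<rho> P1 shear_def k_def)
      show "g v $ 2 = (unip q0 \<circ> shear k) v $ 2"
        unfolding gv using norm_unips_L1[OF g, of "vec3 (v $ 1) 0 0"] by (simp add: \<beta> Q shear_def)
      show "g v $ 3 = (unip q0 \<circ> shear k) v $ 3"
        unfolding norm_unips_nth_3[OF g] by (simp add: top_coord shear_def)
    qed
  qed
  then show ?thesis by (intro exI[of _ q0] exI[of _ k] ext)
qed

text \<open>With a trivial field automorphism, \<open>twist g\<close> and \<open>top_coord g\<close>
  are multiplications by scalars. The \<open>p\<close>-power order of \<open>g\<close> passes to
  these scalars, which are then 1.\<close>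

lemma norm_unips_pow_card_imp_trivial:
  assumes g: "g \<in> norm_unips" and twist_hom: "\<And>x. twist_hom g x = x" and pow: "g ^^ (CARD('a) ^ k) = id"
  shows "twist g x = x" "top_coord g 1 = 1"
proof -
  have mem: "g ^^ j \<in> norm_unips" for j
  proof (induction j)
    case (Suc j)
    show ?case
      unfolding funpow.simps(2) by (rule perm_groupD(4)[OF perm_group_norm_unips g Suc])
  qed (simp only: funpow.simps(1) perm_groupD(1)[OF perm_group_norm_unips])
  have twist: "twist g x = twist g 1 * x" for x using twist_eq_twist_hom[OF g, of x] by (simp add: twist_hom)
  have top_coord: "top_coord g c = top_coord g 1 * c" for c using top_coord_eq_twist_hom[OF g, of c] by (simp add: twist_hom)
  have twist_id: "twist id x = x" for x
    using twist_unip[of 0 x] unfolding unip_0 .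
  have "twist (g ^^ j) 1 = twist g 1 ^ j" for j
  proof (induction j)
    case (Suc j)
    have "twist (g ^^ Suc j) 1 = twist g (twist (g ^^ j) 1)"
      by (simp only: funpow.simps(2) twist_comp[OF g mem])
    also have "\<dots> = twist g 1 * twist (g ^^ j) 1" by (rule twist)
    finally show ?case unfolding Suc.IH power_Suc .
  qed (simp only: funpow.simps(1) twist_id power_0)
  from this[of "CARD('a) ^ k"] have "twist g 1 ^ (CARD('a) ^ k) = 1"
    unfolding pow twist_id by (rule sym)
  then have "twist g 1 = 1" by (rule power_card_power_imp_1)
  then show "twist g x = x" using twist[of x] by simp
  have "(g ^^ j) (vec3 0 0 1) $ 3 = top_coord g 1 ^ j" for j
  proof (induction j)
    case (Suc j)
    show ?case
      unfolding funpow.simps(2) o_apply norm_unips_nth_3[OF g] Suc.IH power_Suc by (rule top_coord)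
  qed (simp only: funpow.simps(1) id_apply vec3_nth power_0)
  from this[of "CARD('a) ^ k"] have "top_coord g 1 ^ (CARD('a) ^ k) = 1"
    unfolding pow id_apply vec3_nth by (rule sym)
  then show "top_coord g 1 = 1" by (rule power_card_power_imp_1)
qed

end

section \<open>Translation designs of skew Hadamard difference sets\<close>

lemma maps_blocks_comp:
  "maps_blocks f \<B> \<B>' \<Longrightarrow> maps_blocks g \<B>' \<B>'' \<Longrightarrow> maps_blocks (g \<circ> f) \<B> \<B>''"
  unfolding maps_blocks_def by (simp add: image_image image_comp[symmetric]) (auto simp: image_image)

lemma maps_blocks_inv:
  assumes "bij f" "maps_blocks f \<B> \<B>'"
  shows "maps_blocks (finv f) \<B>' \<B>"
proof -
  have "finv f ` f ` B = B" for B
    using assms(1) by (simp add: bij_is_inj image_inv_f_f)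
  then show ?thesis
    using assms(2) unfolding maps_blocks_def by (auto simp: image_image)
qed

section \<open>Translations and automorphism groups of a design\<close>

definition transl :: "'v::ab_group_add \<Rightarrow> 'v \<Rightarrow> 'v" where
  "transl h = (\<lambda>v. v + h)"

definition transl_group :: "('v::ab_group_add \<Rightarrow> 'v) set" where
  "transl_group = range transl"

definition design_auts :: "'v::ab_group_add set \<Rightarrow> ('v \<Rightarrow> 'v) set" where
  "design_auts D = {g. bij g \<and> maps_blocks g (des D) (des D)}"

text \<open>Additive, but not necessarily linear over the field. By \<open>linear_auts_fix_D\<close>
  these maps stabilize \<open>D\<close> itself when \<open>D\<close> is in
  \<open>DD\<close>.\<close>

definition linear_auts :: "'v::ab_group_add set \<Rightarrow> ('v \<Rightarrow> 'v) set" where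
  "linear_auts D = {g \<in> design_auts D. additive g}"

lemma des_eq: "des D = range (\<lambda>h. transl h ` D)"
  by (auto simp: des_def transl_def)

lemma transl_comp: "transl h \<circ> transl k = transl (h + k)"
  by (simp add: transl_def fun_eq_iff algebra_simps)

lemma transl_0: "transl 0 = id"
  by (simp add: transl_def fun_eq_iff)

lemma bij_transl: "bij (transl h)"
  using transl_comp[of h "- h"] transl_comp[of "- h" h] transl_0
  by (intro o_bij[of "transl (- h)"]) simp_all

lemma inv_transl: "finv (transl h) = transl (- h)"
  by (intro inv_equality) (simp_all add: transl_def)

lemma transl_in [simp]: "transl h \<in> transl_group"
  by (simp add: transl_group_def)

lemma perm_group_transl_group: "perm_group (transl_group :: ('v::ab_group_add \<Rightarrow> 'v) set)"
proof (rule perm_groupI)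
  show "id \<in> (transl_group :: ('v \<Rightarrow> 'v) set)" using transl_in[of "0 :: 'v"] unfolding transl_0 .
qed (auto simp: transl_group_def bij_transl inv_transl transl_comp)

lemma transl_eq_iff: "transl h = transl k \<longleftrightarrow> h = k"
proof
  assume "transl h = transl k"
  then have "transl h 0 = transl k 0" by simp
  then show "h = k" by (simp add: transl_def)
qed simp

lemma card_transl_group: "card (transl_group :: ('v::ab_group_add \<Rightarrow> 'v) set) = CARD('v)"
  unfolding transl_group_def by (rule card_image) (simp add: inj_on_def transl_eq_iff)

lemma perm_group_design_auts: "perm_group (design_auts D)"
proof (rule perm_groupI)
  show "id \<in> design_auts D" by (simp add: design_auts_def maps_blocks_def)
  show "bij f" if "f \<in> design_auts D" for f using that by (simp add: design_auts_def)
  show "finv f \<in> design_auts D" if "f \<in> design_auts D" for f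
    using that by (simp add: design_auts_def bij_imp_bij_inv maps_blocks_inv)
  show "f \<circ> g \<in> design_auts D" if "f \<in> design_auts D" "g \<in> design_auts D" for f g
    using that maps_blocks_comp[of g "des D" "des D" f "des D"] by (simp add: design_auts_def bij_comp)
qed

lemma linear_autsD:
  assumes "g \<in> linear_auts D"
  shows "g \<in> design_auts D" "additive g" "bij g"
  using assms by (auto simp: linear_auts_def design_auts_def)

lemma perm_group_linear_auts: "perm_group (linear_auts D)"
proof (rule perm_groupI)
  note G = perm_groupD[OF perm_group_design_auts[of D]]
  show "id \<in> linear_auts D" using G(1) by (simp add: linear_auts_def additive_def)
  show "bij f" if "f \<in> linear_auts D" for f by (rule linear_autsD(3)[OF that])
  show "finv f \<in> linear_auts D" if "f \<in> linear_auts D" for f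
    using linear_autsD[OF that] G(3) additive_inv by (simp add: linear_auts_def)
  show "f \<circ> g \<in> linear_auts D" if "f \<in> linear_auts D" "g \<in> linear_auts D" for f g
    using linear_autsD[OF that(1)] linear_autsD[OF that(2)] G(4) additive_comp by (simp add: linear_auts_def)
qed

lemma transl_group_subset_auts: "transl_group \<subseteq> design_auts D"
proof
  fix f :: "'a \<Rightarrow> 'a" assume "f \<in> transl_group"
  then obtain h where f: "f = transl h" by (auto simp: transl_group_def)
  have "(\<lambda>k. transl h ` transl k ` D) ` UNIV = (\<lambda>k. transl k ` D) ` (\<lambda>k. h + k) ` UNIV"
    unfolding image_comp transl_comp o_def[of _ "\<lambda>k. h + k"] ..
  also have "range (\<lambda>k. h + k) = UNIV" by (metis surj_plus)
  finally show "f \<in> design_auts D"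
    by (simp add: design_auts_def maps_blocks_def f bij_transl des_eq image_image)
qed

lemma additive_transl:
  assumes "additive g"
  shows "g \<circ> transl h = transl (g h) \<circ> g"
  using additiveD(1)[OF assms] by (simp add: transl_def fun_eq_iff)

lemma linear_autsI:
  assumes "additive g" "bij g" "g ` D = D"
  shows "g \<in> linear_auts D"
proof -
  have "g ` transl h ` D = transl (g h) ` D" for h
  proof -
    have "g ` transl h ` D = transl (g h) ` g ` D"
      unfolding image_comp additive_transl[OF assms(1)] ..
    then show ?thesis unfolding assms(3) .
  qed
  then have "(\<lambda>B. g ` B) ` des D = (\<lambda>h. transl h ` D) ` range g"
    unfolding des_eq image_image by simp
  then have "maps_blocks g (des D) (des D)"
    unfolding maps_blocks_def des_eq bij_is_surj[OF assms(2)] .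
  then show ?thesis using assms by (simp add: linear_auts_def design_auts_def)
qed

lemma inv_additive_group: "inv\<^bsub>additive_group\<^esub> (x::'v::ab_group_add) = - x"
  by (rule group.inv_equality[OF group_additive_group]) (simp_all add: additive_group_def)

locale skew_design = odd_finite_field p n ty for p n and ty :: "'a::finite_field itself" +
  fixes D :: "('a ^ 3) set"
  assumes D_in_DD: "D \<in> DD"
begin

lemma skew:
  "v \<noteq> 0 \<Longrightarrow> v \<in> D \<or> - v \<in> D" "v \<in> D \<Longrightarrow> - v \<notin> D" "0 \<notin> D"
  "\<exists>l. \<forall>h. h \<noteq> 0 \<longrightarrow> card {(x, y). x \<in> D \<and> y \<in> D \<and> h = x - y} = l"
proof -
  have *: "skew_Hadamard_difference_set additive_group D" using D_in_DD by (simp add: DD_def)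
  have set_inv: "set_inv\<^bsub>additive_group\<^esub> D = uminus ` D"
    by (auto simp: SET_INV_def inv_additive_group)
  have sel: "carrier additive_group = (UNIV :: ('a ^ 3) set)" "\<one>\<^bsub>additive_group\<^esub> = (0 :: 'a ^ 3)"
    "\<And>x y. x \<otimes>\<^bsub>additive_group\<^esub> y = (x :: 'a ^ 3) + y"
    by (simp_all add: additive_group_def)
  note ** = *[unfolded skew_Hadamard_difference_set_def set_inv inv_additive_group sel]
  then have part: "UNIV - {0} = D \<union> uminus ` D" "D \<inter> uminus ` D = {}"
    by simp_all
  from ** have "\<exists>l. \<forall>h \<in> UNIV - {0}. card {(x, y). x \<in> D \<and> y \<in> D \<and> h = x + - y} = l"
    by (elim conjE)
  then show "\<exists>l. \<forall>h. h \<noteq> 0 \<longrightarrow> card {(x, y). x \<in> D \<and> y \<in> D \<and> h = x - y} = l"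
    by (elim ex_forward) simp
  show "v \<in> D \<or> - v \<in> D" if "v \<noteq> 0"
  proof -
    from that have "v \<in> UNIV - {0}" by simp
    then have "v \<in> D \<union> uminus ` D" unfolding part(1) .
    then show ?thesis by auto
  qed
  show "- v \<notin> D" if "v \<in> D"
  proof
    assume "- v \<in> D"
    then have "- (- v) \<in> uminus ` D" by (rule imageI)
    then have "v \<in> D \<inter> uminus ` D" using that by simp
    then show False unfolding part(2) by simp
  qed
  have "(0 :: 'a ^ 3) \<notin> UNIV - {0}" by simp
  then show "0 \<notin> D" unfolding part(1) by simp
qed

lemma A_orbit_closed:
  assumes "s \<in> nonzero_squares" "v \<in> D"
  shows "s *s unip x v \<in> D"
proof -
  obtain \<O> where O: "\<O> \<subseteq> orbits A_group UNIV (*v)" "D = \<Union>\<O>"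
    using D_in_DD by (auto simp: DD_def)
  then obtain w where w: "orbit A_group (*v) w \<in> \<O>" "v \<in> orbit A_group (*v) w"
    using assms(2) unfolding orbits_def by blast
  have app: "(\<chi> i j. t * E_mat y $ i $ j) *v u = t *s unip y u" for t y u
    by (simp add: vec_eq_iff unip_def matrix_vector_mult_def sum_distrib_left mult.assoc)
  have orb: "orbit A_group (*v) u = {t *s unip y u | t y. t \<in> nonzero_squares}" for u :: "'a ^ 3"
  proof (intro equalityI subsetI)
    fix z assume "z \<in> orbit A_group (*v) u"
    then obtain t y where "t \<in> nonzero_squares" "z = (\<chi> i j. t * E_mat y $ i $ j) *v u"
      unfolding orbit_def A_group_def by auto
    then show "z \<in> {t *s unip y u | t y. t \<in> nonzero_squares}" unfolding app by blast
  next
    fix z assume "z \<in> {t *s unip y u | t y. t \<in> nonzero_squares}"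
    then show "z \<in> orbit A_group (*v) u"
      unfolding orbit_def A_group_def app[symmetric] by auto
  qed
  obtain t y where v: "t \<in> nonzero_squares" "v = t *s unip y w"
    using w(2) unfolding orb by blast
  obtain a b where "a \<noteq> 0" "s = a\<^sup>2" "b \<noteq> 0" "t = b\<^sup>2"
    using assms(1) v(1) by (auto simp: nonzero_squares_def)
  then have st: "s * t \<in> nonzero_squares"
    unfolding nonzero_squares_def by (auto simp: power_mult_distrib intro!: exI[of _ "a * b"])
  have "s *s unip x v = (s * t) *s unip (x + y) w"
    unfolding v(2) unip_add[symmetric] by (simp add: vec_eq_3 algebra_simps)
  then have "s *s unip x v \<in> orbit A_group (*v) w"
    unfolding orb using st by blast
  then show ?thesis using w(1) O(2) by blast
qed

section \<open>Squares and their action on \<open>D\<close>\<close>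

lemma one_in_squares: "(1::'a) \<in> nonzero_squares"
  unfolding nonzero_squares_def by (auto intro!: exI[of _ 1])

lemma unip_D: "v \<in> D \<Longrightarrow> unip x v \<in> D"
  using A_orbit_closed[OF one_in_squares, of v x] by simp

lemma unip_D_iff: "unip x v \<in> D \<longleftrightarrow> v \<in> D"
proof
  assume "unip x v \<in> D"
  then have "unip (- x) (unip x v) \<in> D" by (rule unip_D)
  moreover have "unip (- x) (unip x v) = v"
    using fun_cong[OF unip_add[of "- x" x], of v] by (simp add: unip_0)
  ultimately show "v \<in> D" by simp
qed (rule unip_D)

lemma scale_D: "s \<in> nonzero_squares \<Longrightarrow> v \<in> D \<Longrightarrow> s *s v \<in> D"
  using A_orbit_closed[of s v 0] by (simp add: unip_0)

lemma nonzero_squares_inverse: "(s::'a) \<in> nonzero_squares \<Longrightarrow> inverse s \<in> nonzero_squares"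
  unfolding nonzero_squares_def
  by (clarsimp, rule_tac x = "inverse t" in exI) (simp add: power_inverse)

lemma nonzero_squares_neq_0: "(s::'a) \<in> nonzero_squares \<Longrightarrow> s \<noteq> 0"
  by (auto simp: nonzero_squares_def)

text \<open>Multiplication by a square preserves \<open>D\<close>, whereas negation moves every
  element of \<open>D\<close> out of it.\<close>

lemma uminus_one_nonsquare: "(- 1 :: 'a) \<notin> nonzero_squares"
proof
  assume *: "(- 1 :: 'a) \<in> nonzero_squares"
  obtain v where v: "v \<in> D" using skew(1)[of "vec3 0 0 1"] by (auto simp: vec_eq_3)
  then show False using scale_D[OF * v] skew(2)[OF v] by (simp add: vec_eq_iff)
qed

text \<open>Squares and their negatives are disjoint because -1 is not a square. Squaring has fibres
  of size at most two, so together they are numerous enough to fill the nonzero elements.\<close>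

lemma square_or_neg_square:
  assumes "(c::'a) \<noteq> 0"
  shows "c \<in> nonzero_squares \<or> - c \<in> nonzero_squares"
proof -
  define S where "S = (nonzero_squares :: 'a set)"
  have S: "finite S" "0 \<notin> S" by (auto simp: S_def nonzero_squares_def)
  have disj: "S \<inter> uminus ` S = {}"
  proof (rule ccontr)
    assume "S \<inter> uminus ` S \<noteq> {}"
    then obtain y where "- y \<in> S" "y \<in> S" by auto
    then obtain a b :: 'a where ab: "a \<noteq> 0" "- y = a\<^sup>2" "b \<noteq> 0" "y = b\<^sup>2"
      by (auto simp: S_def nonzero_squares_def)
    then have "a\<^sup>2 = - (b\<^sup>2)" by simp
    then have "(a / b)\<^sup>2 = - 1" using ab(3) by (simp add: power_divide)
    then have "(- 1 :: 'a) \<in> nonzero_squares"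
      using ab(1,3) unfolding nonzero_squares_def by (intro CollectI exI[of _ "a / b"]) simp
    then show False using uminus_one_nonsquare by contradiction
  qed
  have fibre: "card {t::'a. t\<^sup>2 = s} \<le> 2" for s
  proof (cases "\<exists>u. u\<^sup>2 = s")
    case True
    then obtain u where "u\<^sup>2 = s" by blast
    then have "{t. t\<^sup>2 = s} \<subseteq> {u, - u}" by (auto simp: power2_eq_iff)
    then have "card {t. t\<^sup>2 = s} \<le> card {u, - u}" by (intro card_mono) auto
    also have "\<dots> \<le> 2" by (simp add: card_insert_if)
    finally show ?thesis .
  qed simp
  have "UNIV - {0::'a} \<subseteq> (\<Union>s\<in>S. {t. t\<^sup>2 = s})"
    by (auto simp: S_def nonzero_squares_def)
  then have "card (UNIV - {0::'a}) \<le> card (\<Union>s\<in>S. {t::'a. t\<^sup>2 = s})"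
    by (intro card_mono) auto
  also have "\<dots> \<le> (\<Sum>s\<in>S. card {t::'a. t\<^sup>2 = s})" by (rule card_UN_le[OF S(1)])
  also have "\<dots> \<le> (\<Sum>s\<in>S. 2)" by (intro sum_mono fibre)
  also have "\<dots> = card (S \<union> uminus ` S)"
    using disj S(1) by (simp add: card_Un_disjoint card_image inj_on_def)
  finally have "card (UNIV - {0::'a}) \<le> card (S \<union> uminus ` S)" .
  moreover have "S \<union> uminus ` S \<subseteq> UNIV - {0}" using S(2) by auto
  ultimately have "S \<union> uminus ` S = UNIV - {0}"
    by (intro card_seteq) auto
  then have "c \<in> S \<union> uminus ` S" using assms by blast
  then show ?thesis by (auto simp: S_def)
qed

section \<open>Cardinalities and the multiplicity of differences\<close>

lemma card_vec3: "card {v :: 'a ^ 3. v $ 3 = 0} = CARD('a) ^ 2" "CARD('a ^ 3) = CARD('a) ^ 3"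
proof -
  have "{v :: 'a ^ 3. v $ 3 = 0} = (\<lambda>(a, b). vec3 a b 0) ` UNIV"
  proof (intro equalityI subsetI)
    fix v :: "'a ^ 3" assume "v \<in> {v. v $ 3 = 0}"
    then have "v = (\<lambda>(a, b). vec3 a b 0) (v $ 1, v $ 2)" by (simp add: vec_eq_3)
    then show "v \<in> (\<lambda>(a, b). vec3 a b 0) ` UNIV" by blast
  qed auto
  moreover have "inj (\<lambda>(a, b). vec3 a b (0::'a))" by (auto simp: inj_on_def vec_eq_3)
  ultimately show "card {v :: 'a ^ 3. v $ 3 = 0} = CARD('a) ^ 2"
    by (simp add: card_image card_prod[where 'a = 'a and 'b = 'a] power2_eq_square)
  show "CARD('a ^ 3) = CARD('a) ^ 3" by simp
qed

text \<open>The nonzero part of \<open>H\<close> is the disjoint union of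
  \<open>D \<inter> H\<close> and its negative.\<close>

lemma card_skew_half:
  assumes "0 \<in> H" "\<And>v. v \<in> H \<Longrightarrow> - v \<in> H"
  shows "card H = 2 * card (D \<inter> H) + 1"
proof -
  have "H = insert 0 ((D \<inter> H) \<union> uminus ` (D \<inter> H))"
  proof (intro equalityI subsetI)
    fix v assume v: "v \<in> H"
    show "v \<in> insert 0 ((D \<inter> H) \<union> uminus ` (D \<inter> H))"
    proof (cases "v = 0")
      case False
      then consider "v \<in> D" | "- v \<in> D" using skew(1) by blast
      then show ?thesis
      proof cases
        case 2
        then have "- v \<in> D \<inter> H" using assms(2)[OF v] by simp
        then have "- (- v) \<in> uminus ` (D \<inter> H)" by (rule imageI)
        then show ?thesis by simp
      qed (use v in simp)
    qed simp
  qed (use assms in auto)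
  moreover have "0 \<notin> (D \<inter> H) \<union> uminus ` (D \<inter> H)" using skew(3) by auto
  moreover have "(D \<inter> H) \<inter> uminus ` (D \<inter> H) = {}" using skew(2) by auto
  ultimately have "card H = Suc (card (D \<inter> H) + card (uminus ` (D \<inter> H)))"
    by (metis card_Un_disjoint card_insert_disjoint finite)
  then show ?thesis by (simp add: card_image)
qed

text \<open>The parameter lambda of the difference set, extracted by \<open>THE\<close> from an
  existence statement.\<close>

definition diff_count :: nat where
  "diff_count = (THE l. \<forall>h. h \<noteq> 0 \<longrightarrow> card {(x, y). x \<in> D \<and> y \<in> D \<and> h = x - y} = l)"

lemma card_differences:
  assumes "h \<noteq> 0"
  shows "card {(x, y). x \<in> D \<and> y \<in> D \<and> h = x - y} = diff_count"
proof -
  obtain l where l: "\<forall>h. h \<noteq> 0 \<longrightarrow> card {(x, y). x \<in> D \<and> y \<in> D \<and> h = x - y} = l"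
    using skew(4) by (elim exE)
  have "diff_count = l"
    unfolding diff_count_def
  proof (rule the_equality)
    show "\<forall>h. h \<noteq> 0 \<longrightarrow> card {(x, y). x \<in> D \<and> y \<in> D \<and> h = x - y} = l" by (rule l)
    fix l' assume l': "\<forall>h. h \<noteq> 0 \<longrightarrow> card {(x, y). x \<in> D \<and> y \<in> D \<and> h = x - y} = l'"
    show "l' = l"
      using l'[rule_format, OF assms] l[rule_format, OF assms] by (simp only:)
  qed
  then show ?thesis using l[rule_format, OF assms] by (simp only:)
qed

text \<open>Sort the pairs by their difference: 0 contributes the diagonal of \<open>D\<close>, and
  every other element of \<open>H\<close> contributes \<open>diff_count\<close>.\<close>

lemma card_pairs_differences:
  assumes "0 \<in> H"
  shows "card {(x, y). x \<in> D \<and> y \<in> D \<and> x - y \<in> H} = card D + diff_count * (card H - 1)"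
proof -
  have "{(x, y). x \<in> D \<and> y \<in> D \<and> x - y \<in> H} = (\<Union>h\<in>H. {(x, y). x \<in> D \<and> y \<in> D \<and> h = x - y})"
    by auto
  also have "card \<dots> = (\<Sum>h\<in>H. card {(x, y). x \<in> D \<and> y \<in> D \<and> h = x - y})"
    by (rule card_UN_disjoint) auto
  also have "\<dots> = card {(x, y). x \<in> D \<and> y \<in> D \<and> 0 = x - y}
      + (\<Sum>h\<in>H - {0}. card {(x, y). x \<in> D \<and> y \<in> D \<and> h = x - y})"
    by (rule sum.remove) (use assms in auto)
  also have "{(x, y). x \<in> D \<and> y \<in> D \<and> 0 = x - y} = (\<lambda>x. (x, x)) ` D" by auto
  also have "card \<dots> = card D" by (rule card_image) (simp add: inj_on_def)
  also have "(\<Sum>h\<in>H - {0}. card {(x, y). x \<in> D \<and> y \<in> D \<and> h = x - y}) = (\<Sum>h\<in>H - {0}. diff_count)"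
    by (rule sum.cong) (simp_all add: card_differences)
  also have "\<dots> = diff_count * (card H - 1)" using assms by simp
  finally show ?thesis .
qed

lemma card_D: "2 * card D + 1 = CARD('a) ^ 3"
  using card_skew_half[of UNIV] card_vec3(2) by simp

text \<open>Take \<open>H\<close> to be the whole space in \<open>card_pairs_differences\<close> and
  cancel \<open>card D\<close>.\<close>

lemma card_D_diff_count: "card D = 2 * diff_count + 1"
proof -
  have "{(x, y). x \<in> D \<and> y \<in> D \<and> x - y \<in> UNIV} = D \<times> D" by auto
  then have "card D * card D = card D + diff_count * (CARD('a ^ 3) - 1)"
    using card_pairs_differences[of UNIV] by (simp add: card_cartesian_product)
  also have "CARD('a ^ 3) - 1 = 2 * card D" unfolding card_vec3(2) card_D[symmetric] by simp
  finally have "card D * card D = card D * (2 * diff_count + 1)" by (simp add: algebra_simps)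
  moreover have "card D \<noteq> 0"
    using skew(1)[of "vec3 0 0 1"] by (auto simp: vec_eq_3)
  ultimately show ?thesis by (metis mult_left_cancel)
qed

text \<open>An additive image of \<open>D\<close> is again disjoint from its negative. For a
  translate by \<open>h\<close> this forces \<open>x + (h + h)\<close> into
  \<open>insert 0 D\<close> for every \<open>x\<close> in \<open>D\<close>. So \<open>h + h\<close>
  is a difference at least \<open>card D - 1\<close> times, while \<open>diff_count\<close> is only
  half of that.\<close>

lemma additive_image_transl:
  assumes g: "bij g" "additive g" and im: "g ` D = transl h ` D"
  shows "h = 0"
proof (rule ccontr)
  assume "h \<noteq> 0"
  have h2: "h + h \<noteq> 0"
  proof
    assume "h + h = 0"
    then have "2 * h $ i = 0" for i by (metis mult_2 vector_add_component zero_index)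
    then show False using \<open>h \<noteq> 0\<close> by (simp add: vec_eq_iff)
  qed
  have step: "x + (h + h) \<in> insert 0 D" if "x \<in> D" for x
  proof (rule ccontr)
    assume "x + (h + h) \<notin> insert 0 D"
    then have *: "- (x + (h + h)) \<in> D" using skew(1) by blast
    have mem: "u + h \<in> g ` D" if "u \<in> D" for u
      unfolding im transl_def using that by (rule imageI)
    obtain y where y: "y \<in> D" "x + h = g y"
      using mem[OF \<open>x \<in> D\<close>] by (elim imageE)
    obtain z where z: "z \<in> D" "- (x + (h + h)) + h = g z"
      using mem[OF *] by (elim imageE)
    have "g z = - (x + h)" unfolding z(2)[symmetric] by (simp add: algebra_simps)
    then have "g z = g (- y)" unfolding y(2) additiveD(3)[OF g(2)] .
    then have "z = - y" using bij_is_inj[OF g(1)] by (simp add: inj_eq)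
    then show False using y(1) z(1) skew(2)[of y] by simp
  qed
  \<comment> \<open>Only the element \<open>- (h + h)\<close> can be moved to 0 instead of into
    \<open>D\<close>.\<close>
  have "card D - 1 \<le> card (D - {- (h + h)})" by (simp add: card_Diff_singleton_if)
  also have "\<dots> \<le> card {(x, y). x \<in> D \<and> y \<in> D \<and> h + h = x - y}"
  proof (rule card_inj_on_le[of "\<lambda>y. (y + (h + h), y)"])
    show "(\<lambda>y. (y + (h + h), y)) ` (D - {- (h + h)}) \<subseteq> {(x, y). x \<in> D \<and> y \<in> D \<and> h + h = x - y}"
    proof (rule image_subsetI)
      fix y assume y: "y \<in> D - {- (h + h)}"
      then have "y + (h + h) \<noteq> 0" unfolding add_eq_0_iff2 by simp
      then have "y + (h + h) \<in> D" using y step[of y] by simp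
      then show "(y + (h + h), y) \<in> {(x, y). x \<in> D \<and> y \<in> D \<and> h + h = x - y}"
        using y by simp
    qed
  qed (simp_all add: inj_on_def)
  also have "\<dots> = diff_count" by (rule card_differences[OF h2])
  \<comment> \<open>As \<open>card D = 2 * diff_count + 1\<close>, this leaves a single element in
    \<open>D\<close> and \<open>q^3 = 3\<close>.\<close>
  finally have "diff_count = 0" using card_D_diff_count by simp
  then have "CARD('a) ^ 3 = 3" using card_D card_D_diff_count by simp
  moreover have "3 \<le> CARD('a)"
    using power_increasing[OF n_pos, of p] p_ge_3 card_field by simp
  then have "3 ^ 3 \<le> CARD('a) ^ 3" by (rule power_mono) simp
  ultimately show False by simp
qed

lemma linear_auts_fix_D:
  assumes "g \<in> linear_auts D"
  shows "g ` D = D"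
proof -
  have "maps_blocks g (des D) (des D)" using linear_autsD(1)[OF assms] by (simp add: design_auts_def)
  moreover have "D \<in> des D" unfolding des_eq by (rule range_eqI[of _ _ 0]) (simp add: transl_0)
  ultimately have "g ` D \<in> des D" unfolding maps_blocks_def by blast
  then obtain h where h: "g ` D = transl h ` D" unfolding des_eq by blast
  then have "h = 0" by (rule additive_image_transl[OF linear_autsD(3,2)[OF assms]])
  then show ?thesis using h by (simp add: transl_0)
qed

section \<open>Slices of \<open>D\<close> by the third coordinate\<close>

definition slice_card :: "'a \<Rightarrow> nat" where
  "slice_card c = card {v \<in> D. v $ 3 = c}"

text \<open>Both sides count the pairs in \<open>D\<close> whose difference has third coordinate
  0.\<close>

lemma sum_slice_card_squares: "(\<Sum>c\<in>UNIV. slice_card c * slice_card c) = card D + diff_count * (CARD('a) ^ 2 - 1)"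
proof -
  have "{(x, y). x \<in> D \<and> y \<in> D \<and> x - y \<in> {v. v $ 3 = 0}} = (\<Union>c. {v \<in> D. v $ 3 = c} \<times> {v \<in> D. v $ 3 = c})"
    by auto
  then have "card {(x, y). x \<in> D \<and> y \<in> D \<and> x - y \<in> {v. v $ 3 = 0}} = card (\<Union>c. {v \<in> D. v $ 3 = c} \<times> {v \<in> D. v $ 3 = c})"
    by (rule arg_cong)
  also have "\<dots> = (\<Sum>c\<in>UNIV. card ({v \<in> D. v $ 3 = c} \<times> {v \<in> D. v $ 3 = c}))"
    by (rule card_UN_disjoint) auto
  finally show ?thesis
    using card_pairs_differences[of "{v. v $ 3 = 0}"] card_vec3(1) by (simp add: slice_card_def card_cartesian_product)
qed

lemma slice_card_0: "2 * slice_card 0 + 1 = CARD('a) ^ 2"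
  using card_skew_half[of "{v. v $ 3 = 0}"] card_vec3(1) by (simp add: slice_card_def Int_def)

text \<open>\<open>U\<close> acts freely on the slice, and each orbit contains exactly one vector
  with second coordinate 0, reached from \<open>v\<close> with the parameter
  \<open>- (v $ 2 / c)\<close>.\<close>

lemma slice_card_slice:
  assumes "c \<noteq> 0"
  shows "slice_card c = CARD('a) * card {a. vec3 a 0 c \<in> D}"
proof -
  have "bij_betw (\<lambda>(x, a). unip x (vec3 a 0 c)) (UNIV \<times> {a. vec3 a 0 c \<in> D}) {v \<in> D. v $ 3 = c}"
  proof (rule bij_betw_byWitness[where f' = "\<lambda>v. (v $ 2 / c, unip (- (v $ 2 / c)) v $ 1)"])
    show "\<forall>a\<in>UNIV \<times> {a. vec3 a 0 c \<in> D}. (\<lambda>v. (v $ 2 / c, unip (- (v $ 2 / c)) v $ 1)) ((\<lambda>(x, a). unip x (vec3 a 0 c)) a) = a"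
    proof (rule ballI)
      fix z :: "'a \<times> 'a"
      obtain x a where z: "z = (x, a)" by (cases z)
      have "unip x (vec3 a 0 c) $ 2 / c = x" using assms by simp
      then show "(\<lambda>v. (v $ 2 / c, unip (- (v $ 2 / c)) v $ 1)) ((\<lambda>(x, a). unip x (vec3 a 0 c)) z) = z"
        by (simp only: z case_prod_conv unip_cancel vec3_nth)
    qed
    have *: "vec3 (unip (- (v $ 2 / c)) v $ 1) 0 c = unip (- (v $ 2 / c)) v" if "v $ 3 = c" for v
      using assms that by (auto simp: vec_eq_3)
    show "\<forall>v\<in>{v \<in> D. v $ 3 = c}. (\<lambda>(x, a). unip x (vec3 a 0 c)) (v $ 2 / c, unip (- (v $ 2 / c)) v $ 1) = v"
      by (simp add: * del: unip_nth)
    show "(\<lambda>(x, a). unip x (vec3 a 0 c)) ` (UNIV \<times> {a. vec3 a 0 c \<in> D}) \<subseteq> {v \<in> D. v $ 3 = c}"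
      by (auto simp: unip_D)
    show "(\<lambda>v. (v $ 2 / c, unip (- (v $ 2 / c)) v $ 1)) ` {v \<in> D. v $ 3 = c} \<subseteq> UNIV \<times> {a. vec3 a 0 c \<in> D}"
      by (rule image_subsetI) (simp add: * unip_D del: unip_nth)
  qed
  then show ?thesis unfolding slice_card_def by (simp add: bij_betw_same_card[symmetric] card_cartesian_product)
qed

lemma slice_card_square:
  assumes "s \<in> nonzero_squares"
  shows "slice_card (s * c) = slice_card c"
proof -
  have "bij_betw (\<lambda>v. s *s v) {v \<in> D. v $ 3 = c} {v \<in> D. v $ 3 = s * c}"
    by (rule bij_betw_byWitness[where f' = "\<lambda>v. inverse s *s v"])
      (use nonzero_squares_neq_0[OF assms] scale_D[OF assms] scale_D[OF nonzero_squares_inverse[OF assms]] in \<open>auto simp: vec_eq_3\<close>)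
  then show ?thesis unfolding slice_card_def by (rule bij_betw_same_card[symmetric])
qed

text \<open>Negation carries the slice of \<open>D\<close> at \<open>- c\<close> to the complement
  of \<open>D\<close> at height \<open>c\<close>.\<close>

lemma slice_card_uminus:
  assumes "c \<noteq> 0"
  shows "slice_card (- c) + slice_card c = CARD('a) ^ 2"
proof -
  have "bij_betw uminus {v \<in> D. v $ 3 = - c} {v. - v \<in> D \<and> v $ 3 = c}"
    by (rule bij_betw_byWitness[where f' = uminus]) auto
  then have "slice_card (- c) = card {v. - v \<in> D \<and> v $ 3 = c}" unfolding slice_card_def by (rule bij_betw_same_card)
  then have "slice_card (- c) + slice_card c = card ({v. - v \<in> D \<and> v $ 3 = c} \<union> {v \<in> D. v $ 3 = c})"
    unfolding slice_card_def using skew(2) by (subst card_Un_disjoint) auto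
  also have "{v. - v \<in> D \<and> v $ 3 = c} \<union> {v \<in> D. v $ 3 = c} = {v. v $ 3 = c}"
  proof -
    have "v \<in> D \<or> - v \<in> D" if "v $ 3 = c" for v
      by (rule skew(1)) (use that assms in auto)
    then show ?thesis by auto
  qed
  also have "card \<dots> = card {v :: 'a ^ 3. v $ 3 = 0}"
    by (rule bij_betw_same_card[of "\<lambda>v. v - vec3 0 0 c"], rule bij_betw_byWitness[where f' = "\<lambda>v. v + vec3 0 0 c"]) auto
  finally show ?thesis using card_vec3(1) by simp
qed

text \<open>A nonzero value \<open>k c\<close> makes the slice at \<open>c\<close> periodic, so
  \<open>slice_card c\<close> is divisible by \<open>p q\<close>. All other nonzero heights inherit
  this, and \<open>sum_slice_card_squares\<close> modulo \<open>p^2 q^2\<close> then contradicts the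
  values of \<open>slice_card 0\<close>, \<open>card D\<close> and
  \<open>diff_count\<close>.\<close>

lemma shear_trivial:
  assumes inv: "shear k ` D = D" and k0: "k 0 = 0"
  shows "k c = 0"
proof (rule ccontr)
  assume kc: "k c \<noteq> 0"
  then have c: "c \<noteq> 0" using k0 by auto
  have "p dvd card {a. vec3 a 0 c \<in> D}"
  proof (rule p_dvd_card_periodic[OF kc])
    fix a assume "a \<in> {a. vec3 a 0 c \<in> D}"
    then have "shear k (vec3 a 0 c) \<in> D" using inv by blast
    moreover have "shear k (vec3 a 0 c) = vec3 (a + k c) 0 c" by (simp add: shear_def vec_eq_3)
    ultimately show "a + k c \<in> {a. vec3 a 0 c \<in> D}" by simp
  qed
  then have Nc: "p * CARD('a) dvd slice_card c" unfolding slice_card_slice[OF c] by (simp add: mult.commute)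
  have pq: "p dvd CARD('a)" unfolding card_field using n_pos by (simp add: dvd_power)
  \<comment> \<open>Heights that differ by a square factor have slices of equal size; the remaining
    ones follow by negation, since \<open>p q\<close> divides \<open>q^2\<close>.\<close>
  have slice_card: "p * CARD('a) dvd slice_card b" if "b \<noteq> 0" for b
  proof -
    have "b / c \<noteq> 0" using that c by simp
    then consider "b / c \<in> nonzero_squares" | "- (b / c) \<in> nonzero_squares" using square_or_neg_square by blast
    then show ?thesis
    proof cases
      case 1
      then show ?thesis using slice_card_square[OF 1, of c] Nc c by simp
    next
      case 2
      have "p * CARD('a) dvd slice_card (- b)" using slice_card_square[OF 2, of c] Nc c by simp
      moreover have "p * CARD('a) dvd slice_card (- b) + slice_card b"
        unfolding slice_card_uminus[OF that] power2_eq_square using pq by (rule mult_dvd_mono) simp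
      ultimately show ?thesis by (simp add: dvd_add_right_iff)
    qed
  qed
  define Q P where "Q = int CARD('a)" and "P = int p"
  have "p * CARD('a) * (p * CARD('a)) dvd (\<Sum>b\<in>UNIV - {0}. slice_card b * slice_card b)"
    by (rule dvd_sum) (use slice_card in \<open>auto intro: mult_dvd_mono\<close>)
  then obtain m where "(\<Sum>b\<in>UNIV - {0}. slice_card b * slice_card b) = p * CARD('a) * (p * CARD('a)) * m" by (elim dvdE)
  then have "slice_card 0 * slice_card 0 + p * CARD('a) * (p * CARD('a)) * m = card D + diff_count * (CARD('a) ^ 2 - 1)"
    using sum_slice_card_squares sum.remove[of UNIV "0::'a" "\<lambda>c. slice_card c * slice_card c"] by simp
  then have "int (slice_card 0 * slice_card 0 + p * CARD('a) * (p * CARD('a)) * m) = int (card D + diff_count * (CARD('a) ^ 2 - 1))" by simp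
  moreover have "int (CARD('a) ^ 2 - 1) = Q\<^sup>2 - 1"
    using slice_card_0 by (simp add: Q_def of_nat_diff)
  ultimately have eq: "int (slice_card 0) * int (slice_card 0) + P * Q * (P * Q) * int m = int (card D) + int diff_count * (Q\<^sup>2 - 1)"
    by (simp add: P_def Q_def)
  have 1: "2 * int (slice_card 0) = Q\<^sup>2 - 1" using arg_cong[OF slice_card_0, of int] by (simp add: Q_def)
  have 2: "2 * int (card D) = Q ^ 3 - 1" using arg_cong[OF card_D, of int] by (simp add: Q_def)
  have 3: "4 * int diff_count = Q ^ 3 - 3" using 2 arg_cong[OF card_D_diff_count, of int] by simp
  \<comment> \<open>Multiplying by 4 clears the denominators in the three values above.\<close>
  have "(2 * int (slice_card 0)) * (2 * int (slice_card 0)) + 4 * (P * Q * (P * Q) * int m) = 2 * (2 * int (card D)) + 4 * int diff_count * (Q\<^sup>2 - 1)"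
    using arg_cong[OF eq, of "\<lambda>x. 4 * x"] by (simp add: algebra_simps)
  then have "Q\<^sup>2 * (Q ^ 3 - Q\<^sup>2 + Q - 1) = Q\<^sup>2 * (P * (4 * P * int m))"
    unfolding 1 2 3 by (simp add: algebra_simps power2_eq_square power3_eq_cube)
  moreover have "Q\<^sup>2 \<noteq> 0" by (simp add: Q_def)
  \<comment> \<open>The right side is divisible by \<open>p\<close>, whereas the left side is -1
    modulo \<open>p\<close>.\<close>
  ultimately have "Q ^ 3 - Q\<^sup>2 + Q - 1 = P * (4 * P * int m)" by (metis mult_left_cancel)
  then have "1 = Q * (Q\<^sup>2 - Q + 1) - P * (4 * P * int m)"
    by (simp add: algebra_simps power2_eq_square power3_eq_cube)
  moreover have "P dvd Q" using pq by (simp add: P_def Q_def)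
  ultimately have "P dvd 1" by (metis dvd_diff dvd_mult2 dvd_triv_left)
  then show False using p_ge_3 by (simp add: P_def)
qed

text \<open>Such a \<open>g\<close> is an element of \<open>U\<close> times a shear. Since
  \<open>g\<close> and \<open>U\<close> preserve \<open>D\<close>, so does the shear, which is
  therefore trivial.\<close>

lemma linear_aut_in_unips:
  assumes "g \<in> linear_auts D" "g \<in> norm_unips" "\<And>x. twist g x = x" "top_coord g 1 = 1"
  shows "g \<in> unips"
proof -
  obtain b k where g: "g = unip b \<circ> shear k" using norm_unips_unip_shear[OF assms(2-4)] by blast
  have "unip (- b) ` D = D"
  proof (intro equalityI subsetI)
    fix v assume v: "v \<in> D"
    have "v = unip (- b) (unip b v)" using fun_cong[OF unip_add[of "- b" b], of v] by (simp add: unip_0)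
    then show "v \<in> unip (- b) ` D" using unip_D[OF v] by blast
  qed (auto simp: unip_D)
  moreover have "shear k = unip (- b) \<circ> g"
    unfolding g comp_assoc[symmetric] unip_add by (simp add: unip_0)
  ultimately have "shear k ` D = D"
    using linear_auts_fix_D[OF assms(1)] by (simp only: image_comp[symmetric])
  moreover have "k 0 = 0"
  proof -
    have "g 0 = 0" by (rule additiveD(2)[OF linear_autsD(2)[OF assms(1)]])
    from arg_cong[OF this, of "\<lambda>v. v $ 1"] show ?thesis by (simp add: g shear_def)
  qed
  ultimately have "shear k = id"
    using shear_trivial by (simp add: fun_eq_iff shear_def vec_eq_3)
  then show ?thesis by (simp add: g)
qed

lemma unips_subset_linear_auts: "unips \<subseteq> linear_auts D"
proof
  fix f assume "f \<in> (unips :: ('a ^ 3 \<Rightarrow> 'a ^ 3) set)"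
  then obtain x where f: "f = unip x" by (auto simp: unips_def)
  have "unip x ` D = D"
    using unip_D_iff bij_is_surj[OF bij_unip[of x]] by (auto simp: image_iff) (metis surjD)
  then show "f \<in> linear_auts D" unfolding f by (intro linear_autsI additive_unip bij_unip)
qed

end

section \<open>Abelian subgroups normalizing the translations or the unipotent group\<close>

lemma card_le_fibres:
  assumes "finite X" "f ` X \<subseteq> F" "finite F" "card F \<le> k"
    and fibre: "\<And>x. x \<in> X \<Longrightarrow> card {y \<in> X. f y = f x} \<le> m"
  shows "card X \<le> k * m"
proof -
  have "X = (\<Union>z\<in>f ` X. {y \<in> X. f y = z})" by auto
  then have "card X = card (\<Union>z\<in>f ` X. {y \<in> X. f y = z})" by (rule arg_cong)
  also have "\<dots> \<le> (\<Sum>z\<in>f ` X. card {y \<in> X. f y = z})"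
    by (rule card_UN_le) (simp add: assms(1))
  also have "\<dots> \<le> (\<Sum>z\<in>f ` X. m)" by (rule sum_mono) (use fibre in auto)
  also have "\<dots> = card (f ` X) * m" by simp
  also have "\<dots> \<le> k * m"
    using card_mono[OF assms(3,2)] assms(4) by (intro mult_le_mono1) simp
  finally show ?thesis .
qed

section \<open>Affine maps and their linear parts\<close>

definition lin :: "('v::ab_group_add \<Rightarrow> 'v) \<Rightarrow> 'v \<Rightarrow> 'v" where
  "lin b v = b v - b 0"

lemma lin_eq: "lin b = transl (- b 0) \<circ> b"
  by (simp add: fun_eq_iff lin_def transl_def)

text \<open>A map normalizing the translations is affine, since \<open>b (u + h) - b u\<close> does
  not depend on \<open>u\<close>; \<open>lin b\<close> is its linear part.\<close>

lemma additive_lin: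
  assumes "bij b" "conj_set b transl_group = transl_group"
  shows "additive (lin b)"
  unfolding additive_def
proof (intro allI)
  fix v h :: 'a
  have "b \<circ> transl h \<circ> finv b \<in> transl_group"
    using assms(2) transl_in[of h] unfolding conj_set_def by (metis imageI)
  then obtain k where k: "b \<circ> transl h \<circ> finv b = transl k" by (auto simp: transl_group_def)
  have "b (u + h) = b u + k" for u
    using fun_cong[OF k, of "b u"] assms(1) by (simp add: transl_def bij_is_inj)
  from this[of v] this[of 0] show "lin b (v + h) = lin b v + lin b h"
    by (simp add: lin_def)
qed

lemma bij_lin: "bij b \<Longrightarrow> bij (lin b)"
  unfolding lin_eq by (rule bij_comp[OF _ bij_transl])

lemma lin_comp:
  assumes "additive (lin b)"
  shows "lin (b \<circ> c) = lin b \<circ> lin c"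
proof
  fix v
  have "lin b (c v - c 0) = lin b (c v) - lin b (c 0)" by (rule additiveD(4)[OF assms])
  then show "lin (b \<circ> c) v = (lin b \<circ> lin c) v" by (simp add: lin_def)
qed

lemma lin_in_linear_auts:
  assumes "b \<in> design_auts D" "conj_set b transl_group = transl_group"
  shows "lin b \<in> linear_auts D"
proof -
  note G = perm_groupD[OF perm_group_design_auts[of D]]
  have "lin b \<in> design_auts D"
    unfolding lin_eq by (rule G(4)[OF _ assms(1)]) (use transl_group_subset_auts transl_in in blast)
  then show ?thesis using additive_lin[OF G(2)[OF assms(1)] assms(2)] by (simp add: linear_auts_def)
qed

lemma conj_set_commute:
  assumes g: "bij g" and comm: "\<And>a b. a \<in> X \<Longrightarrow> b \<in> X \<Longrightarrow> a \<circ> b = b \<circ> a"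
    and "a \<in> conj_set g X" "b \<in> conj_set g X"
  shows "a \<circ> b = b \<circ> a"
proof -
  obtain a' b' where "a' \<in> X" "a = g \<circ> a' \<circ> finv g" "b' \<in> X" "b = g \<circ> b' \<circ> finv g"
    using assms(3,4) unfolding conj_set_def by (elim imageE)
  then show ?thesis using comm[of a' b'] by (simp only: conj_comp[OF g])
qed

lemma conj_set_design_auts:
  assumes f: "bij f" "maps_blocks f (des D) (des D')"
  shows "conj_set f (design_auts D) \<subseteq> design_auts D'"
proof
  fix h assume "h \<in> conj_set f (design_auts D)"
  then obtain a where a: "a \<in> design_auts D" and h: "h = f \<circ> a \<circ> finv f"
    unfolding conj_set_def by (elim imageE)
  have a': "bij a" "maps_blocks a (des D) (des D)" using a by (simp_all add: design_auts_def)
  have "maps_blocks (f \<circ> a) (des D) (des D')" by (rule maps_blocks_comp[OF a'(2) f(2)])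
  then have "maps_blocks h (des D') (des D')"
    unfolding h by (rule maps_blocks_comp[OF maps_blocks_inv[OF f]])
  moreover have "bij h"
    unfolding h by (intro bij_comp bij_imp_bij_inv f a')
  ultimately show "h \<in> design_auts D'" by (simp add: design_auts_def)
qed

lemma conj_set_linear_auts:
  assumes f: "bij f" "maps_blocks f (des D) (des D')" "additive f"
  shows "conj_set f (linear_auts D) \<subseteq> linear_auts D'"
proof
  fix h assume "h \<in> conj_set f (linear_auts D)"
  then obtain a where a: "a \<in> linear_auts D" and h: "h = f \<circ> a \<circ> finv f"
    unfolding conj_set_def by (elim imageE)
  have "h \<in> conj_set f (design_auts D)"
    unfolding h conj_set_def using linear_autsD(1)[OF a] by simp
  then have "h \<in> design_auts D'" using conj_set_design_auts[OF f(1,2)] by (rule rev_subsetD)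
  moreover have "additive h"
    unfolding h by (intro additive_comp additive_inv f linear_autsD(2)[OF a])
  ultimately show "h \<in> linear_auts D'" by (simp add: linear_auts_def)
qed

section \<open>Bounds from the number of field automorphisms\<close>

context odd_finite_field
begin

lemma n_n_less: "n * n < CARD('a)"
  unfolding card_field by (rule n_square_less_power[OF p_ge_3 n_pos])

text \<open>Here \<open>f\<close> stands for the size of the fixed field of a nontrivial
  automorphism. Squaring the second inequality would give
  \<open>CARD('a) \<le> n * n\<close>.\<close>

lemma no_small_square:
  assumes "f * f \<le> CARD('a)" "CARD('a) \<le> n * f"
  shows False
proof -
  have "CARD('a) * CARD('a) \<le> (n * f) * (n * f)" by (rule mult_le_mono[OF assms(2) assms(2)])
  also have "\<dots> = (n * n) * (f * f)" by simp
  also have "\<dots> \<le> (n * n) * CARD('a)" by (rule mult_le_mono2[OF assms(1)])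
  finally have "CARD('a) \<le> n * n" by simp
  then show False using n_n_less by simp
qed

text \<open>The nonempty fibres of the homomorphism to the at most \<open>n\<close> field
  automorphisms are cosets of its kernel.\<close>

lemma card_le_twist_hom_kernel:
  assumes X: "perm_group X" "finite X" and \<theta>: "\<And>x. x \<in> X \<Longrightarrow> \<theta> x \<in> norm_unips" "\<theta> id = id"
    "\<And>x y. x \<in> X \<Longrightarrow> y \<in> X \<Longrightarrow> \<theta> (x \<circ> y) = \<theta> x \<circ> \<theta> y"
  shows "card X \<le> n * card {x \<in> X. twist_hom (\<theta> x) = id}"
proof (rule card_le_fibres[of X "\<lambda>x. twist_hom (\<theta> x)" "{\<sigma>. field_hom \<sigma>}"])
  note Xd = perm_groupD[OF X(1)]
  show "(\<lambda>x. twist_hom (\<theta> x)) ` X \<subseteq> {\<sigma>. field_hom \<sigma>}"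
    using field_hom_twist_hom[OF \<theta>(1)] by auto
  have twist_hom_id: "twist_hom id y = y" for y using twist_unip[of 0] by (simp add: twist_hom_def unip_0)
  fix x assume x: "x \<in> X"
  show "card {y \<in> X. twist_hom (\<theta> y) = twist_hom (\<theta> x)} \<le> card {x \<in> X. twist_hom (\<theta> x) = id}"
  proof (rule card_inj_on_le[of "\<lambda>y. finv x \<circ> y"])
    show "inj_on (\<lambda>y. finv x \<circ> y) {y \<in> X. twist_hom (\<theta> y) = twist_hom (\<theta> x)}"
    proof (rule inj_onI)
      fix y z assume "finv x \<circ> y = finv x \<circ> z"
      then have "x \<circ> (finv x \<circ> y) = x \<circ> (finv x \<circ> z)" by simp
      then show "y = z" unfolding comp_cancel[OF Xd(2)[OF x]] .
    qed
    show "(\<lambda>y. finv x \<circ> y) ` {y \<in> X. twist_hom (\<theta> y) = twist_hom (\<theta> x)} \<subseteq> {x \<in> X. twist_hom (\<theta> x) = id}"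
    proof (rule image_subsetI)
      fix y assume "y \<in> {y \<in> X. twist_hom (\<theta> y) = twist_hom (\<theta> x)}"
      then have y: "y \<in> X" "twist_hom (\<theta> y) = twist_hom (\<theta> x)" by simp_all
      have eq: "twist_hom (\<theta> (finv x \<circ> z)) u = twist_hom (\<theta> (finv x)) (twist_hom (\<theta> z) u)" if "z \<in> X" for z u
        unfolding \<theta>(3)[OF Xd(3)[OF x] that] by (rule twist_hom_comp[OF \<theta>(1)[OF Xd(3)[OF x]] \<theta>(1)[OF that]])
      have "twist_hom (\<theta> (finv x \<circ> y)) u = u" for u
      proof -
        have "twist_hom (\<theta> (finv x \<circ> y)) u = twist_hom (\<theta> (finv x \<circ> x)) u"
          unfolding eq[OF y(1)] eq[OF x] y(2) ..
        also have "\<dots> = u" unfolding bij_comp_inv(2)[OF Xd(2)[OF x]] \<theta>(2) by (rule twist_hom_id)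
        finally show ?thesis .
      qed
      then show "finv x \<circ> y \<in> {x \<in> X. twist_hom (\<theta> x) = id}"
        using Xd(4)[OF Xd(3)[OF x] y(1)] by (simp add: fun_eq_iff)
    qed
  qed (use X(2) in simp)
qed (use X(2) card_field_homs in simp_all)

lemma top_coord_comp:
  assumes "g \<in> norm_unips"
  shows "top_coord (g \<circ> h) c = top_coord g (top_coord h c)"
  by (simp add: top_coord_def[of "g \<circ> h"] top_coord_def[of h] norm_unips_nth_3[OF assms])

end

context skew_design
begin

text \<open>The part \<open>K\<close> of \<open>B\<close> with trivial field automorphism lies in
  \<open>U\<close> and has index at most \<open>n\<close>. An element \<open>b\<close> of
  \<open>B\<close> outside \<open>U\<close> has a nontrivial automorphism and commutes with
  \<open>K\<close>. This confines the parameters of \<open>K\<close> to the solutions of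
  \<open>twist b x = x\<close>, which are too few by \<open>no_small_square\<close>.\<close>

lemma abelian_normalizing_unips:
  assumes B: "perm_group B" "B \<subseteq> linear_auts D" "card B = CARD('a)"
    and comm: "\<And>a b. a \<in> B \<Longrightarrow> b \<in> B \<Longrightarrow> a \<circ> b = b \<circ> a"
    and norm: "\<And>b. b \<in> B \<Longrightarrow> conj_set b unips = unips"
  shows "B = unips"
proof -
  have norm_unips: "b \<in> norm_unips" if "b \<in> B" for b
    using linear_autsD(2,3)[OF subsetD[OF B(2) that]] norm[OF that] by (simp add: norm_unips_def normalizes_def)
  define K where "K = {b \<in> B. twist_hom b = id}"
  have K: "K \<subseteq> unips"
  proof
    fix b assume "b \<in> K"
    then have b: "b \<in> B" and twist_hom: "\<And>x. twist_hom b x = x" by (simp_all add: K_def)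
    have "b ^^ (CARD('a) ^ 1) = id"
      using perm_group_pow_card[OF B(1) _ b] B(3) by simp
    from norm_unips_pow_card_imp_trivial[OF norm_unips[OF b] twist_hom this]
    show "b \<in> unips" by (intro linear_aut_in_unips subsetD[OF B(2) b] norm_unips[OF b])
  qed
  have card: "CARD('a) \<le> n * card K"
    using card_le_twist_hom_kernel[OF B(1), of "\<lambda>x. x"] norm_unips B(3) by (simp add: K_def)
  have "B \<subseteq> unips"
  proof (rule ccontr)
    assume "\<not> B \<subseteq> unips"
    then obtain b where b: "b \<in> B" "b \<notin> unips" by blast
    then have twist_hom: "twist_hom b \<noteq> id" using K by (auto simp: K_def)
    define f where "f = card {x. twist_hom b x = x}"
    have "K \<subseteq> unip ` {x. twist b 1 * twist_hom b x = x}"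
    proof
      fix k assume k: "k \<in> K"
      then obtain x where x: "k = unip x" using K by (auto simp: unips_def)
      have "b \<circ> unip x = unip x \<circ> b" using comm[OF b(1), of k] k x by (simp add: K_def)
      then have "twist b x = x" by (rule twist_unique[OF norm_unipsD(2)[OF norm_unips[OF b(1)]]])
      then show "k \<in> unip ` {x. twist b 1 * twist_hom b x = x}"
        using twist_eq_twist_hom[OF norm_unips[OF b(1)], of x] x by simp
    qed
    then have "card K \<le> card (unip ` {x. twist b 1 * twist_hom b x = x})" by (intro card_mono) auto
    also have "\<dots> \<le> card {x. twist b 1 * twist_hom b x = x}" by (rule card_image_le) simp
    also have "\<dots> \<le> f"
      unfolding f_def by (rule card_twisted_fixed_field[OF field_hom_twist_hom[OF norm_unips[OF b(1)]]])
    finally have "CARD('a) \<le> n * f" using card by (meson le_trans mult_le_mono2)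
    moreover have "f * f \<le> CARD('a)"
      unfolding f_def by (rule card_fixed_field[OF field_hom_twist_hom[OF norm_unips[OF b(1)]] twist_hom])
    ultimately show False by (rule no_small_square[rotated])
  qed
  then show ?thesis by (rule card_subset_eq[rotated]) (simp_all add: B(3) card_unips)
qed

text \<open>This is the hypothesis \<open>unique\<close> of
  \<open>p_group_normalizes_conjugate\<close> for \<open>U\<close>; it holds because a conjugate of
  \<open>U\<close> is abelian of order \<open>q\<close>.\<close>

lemma conj_unips_unique:
  assumes g: "g \<in> linear_auts D" and norm: "\<And>x. x \<in> conj_set g unips \<Longrightarrow> conj_set x unips = unips"
  shows "conj_set g unips = unips"
proof (rule abelian_normalizing_unips)
  have bij: "bij g" by (rule linear_autsD(3)[OF g])
  show "perm_group (conj_set g unips)" by (rule perm_group_conj_set[OF perm_group_unips bij])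
  show "conj_set g unips \<subseteq> linear_auts D"
    by (rule conj_set_subset[OF perm_group_linear_auts g unips_subset_linear_auts])
  show "card (conj_set g unips) = CARD('a)" by (simp only: card_conj_set[OF bij] card_unips)
  show "a \<circ> b = b \<circ> a" if "a \<in> conj_set g unips" "b \<in> conj_set g unips" for a b
    by (rule conj_set_commute[OF bij _ that]) (auto simp: unips_def unip_add add.commute)
qed (rule norm)

lemma normalizes_conj_unips:
  assumes X: "perm_group X" "card X = p ^ l"
    and \<theta>: "\<And>x. x \<in> X \<Longrightarrow> \<theta> x \<in> linear_auts D" "\<theta> id = id"
      "\<And>x y. x \<in> X \<Longrightarrow> y \<in> X \<Longrightarrow> \<theta> (x \<circ> y) = \<theta> x \<circ> \<theta> y"
  shows "\<exists>g\<in>linear_auts D. \<forall>x\<in>X. conj_set (finv g \<circ> \<theta> x \<circ> g) unips = unips"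
  by (rule p_group_normalizes_conjugate[OF perm_group_linear_auts _ perm_group_unips
        unips_subset_linear_auts _ prime_p conj_unips_unique X \<theta>])
    (simp_all only: card_unips card_field finite)

text \<open>The elements of \<open>B\<close> are affine, and their linear parts can be conjugated
  into the normalizer of \<open>U\<close>. \<open>W\<close> collects the translations in
  \<open>B\<close>, and \<open>K\<close> the elements with trivial field automorphism, at least one
  in \<open>n\<close>. As \<open>B\<close> is abelian, elements of \<open>W\<close> translate by
  vectors fixed by all linear parts. Hence a nontrivial linear part makes \<open>W\<close>, and with
  it \<open>K\<close>, too small.\<close>

lemma abelian_normalizing_transl_group:
  assumes B: "perm_group B" "B \<subseteq> design_auts D" "card B = CARD('a) ^ 3"
    and comm: "\<And>a b. a \<in> B \<Longrightarrow> b \<in> B \<Longrightarrow> a \<circ> b = b \<circ> a"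
    and norm: "\<And>b. b \<in> B \<Longrightarrow> conj_set b transl_group = transl_group"
  shows "B = transl_group"
proof -
  note Bd = perm_groupD[OF B(1)]
  have lin_aut: "lin b \<in> linear_auts D" if "b \<in> B" for b
    by (rule lin_in_linear_auts[OF subsetD[OF B(2) that] norm[OF that]])
  have lin_id: "lin id = id" by (simp add: fun_eq_iff lin_def)
  have "card B = p ^ (n * 3)" by (simp only: B(3) card_field power_mult)
  then obtain g where g: "g \<in> linear_auts D"
    and gB: "\<And>x. x \<in> B \<Longrightarrow> conj_set (finv g \<circ> lin x \<circ> g) unips = unips"
    using normalizes_conj_unips[OF B(1) _ lin_aut lin_id lin_comp[OF linear_autsD(2)[OF lin_aut]]] by blast
  note L = perm_groupD[OF perm_group_linear_auts[of D]]
  have bij_g: "bij g" by (rule L(2)[OF g])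
  define \<theta> where "\<theta> x = finv g \<circ> lin x \<circ> g" for x
  have \<theta>_aut: "\<theta> x \<in> linear_auts D" if "x \<in> B" for x
    unfolding \<theta>_def by (rule L(4)[OF L(4)[OF L(3)[OF g] lin_aut[OF that]] g])
  have \<theta>_norm_unips: "\<theta> x \<in> norm_unips" if "x \<in> B" for x
    using linear_autsD(2,3)[OF \<theta>_aut[OF that]] gB[OF that] by (simp add: norm_unips_def normalizes_def \<theta>_def)
  have \<theta>_id: "\<theta> id = id"
    by (simp only: \<theta>_def lin_id comp_id bij_comp_inv[OF bij_g])
  have \<theta>_comp: "\<theta> (x \<circ> y) = \<theta> x \<circ> \<theta> y" if "x \<in> B" "y \<in> B" for x y
    by (simp only: \<theta>_def lin_comp[OF linear_autsD(2)[OF lin_aut[OF that(1)]]] comp_assoc comp_cancel[OF bij_g])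
  define K where "K = {x \<in> B. twist_hom (\<theta> x) = id}"
  define W where "W = {x \<in> B. \<theta> x = id}"
  have pow: "x ^^ j \<in> B \<and> \<theta> (x ^^ j) = \<theta> x ^^ j" if "x \<in> B" for x j
  proof (induction j)
    case 0
    show ?case by (simp only: funpow.simps(1) Bd(1) \<theta>_id)
  next
    case (Suc j)
    then have m: "x ^^ j \<in> B" and e: "\<theta> (x ^^ j) = \<theta> x ^^ j" by simp_all
    show ?case
      unfolding funpow.simps(2) \<theta>_comp[OF that m] e using Bd(4)[OF that m] by (rule conjI) (rule refl)
  qed
  have K: "\<theta> x \<in> unips" if "x \<in> K" for x
  proof -
    from that have x: "x \<in> B" and twist_hom: "\<And>u. twist_hom (\<theta> x) u = u" by (simp_all add: K_def)
    have "\<theta> x ^^ (CARD('a) ^ 3) = id"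
      using pow[OF x, of "CARD('a) ^ 3"] perm_group_pow_card[OF B(1) finite x] unfolding B(3) by (simp add: \<theta>_id)
    from norm_unips_pow_card_imp_trivial[OF \<theta>_norm_unips[OF x] twist_hom this]
    show ?thesis by (intro linear_aut_in_unips \<theta>_aut[OF x] \<theta>_norm_unips[OF x])
  qed
  have card: "CARD('a) ^ 3 \<le> n * card K"
    unfolding K_def B(3)[symmetric]
    by (rule card_le_twist_hom_kernel[of B \<theta>, OF B(1) finite \<theta>_norm_unips \<theta>_id \<theta>_comp])
  have \<theta>_id_transl: "x = transl (x 0)" if "\<theta> x = id" for x
  proof -
    have "lin x = g \<circ> \<theta> x \<circ> finv g"
      unfolding \<theta>_def comp_assoc comp_cancel[OF bij_g] bij_comp_inv[OF bij_g] comp_id ..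
    also have "\<dots> = id" unfolding that comp_id bij_comp_inv[OF bij_g] ..
    finally have lin: "lin x = id" .
    have "x v - x 0 = v" for v
      using fun_cong[OF lin, of v] by (simp only: lin_def id_apply)
    then have "x v = v + x 0" for v unfolding diff_eq_eq .
    then show ?thesis unfolding transl_def by (rule ext)
  qed
  have W_id: "\<theta> w = id" if "w \<in> W" for w using that by (simp add: W_def)
  \<comment> \<open>Commuting with the translation \<open>w\<close> means that \<open>lin b\<close>
    fixes \<open>w 0\<close>, and \<open>finv g\<close> transports this vector to a fixed vector of
    \<open>\<theta> b\<close>.\<close>
  have W_fix: "card W \<le> card {v. \<theta> b v = v}" if b: "b \<in> B" for b
  proof (rule card_inj_on_le[of "\<lambda>w. finv g (w 0)"])
    show "inj_on (\<lambda>w. finv g (w 0)) W"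
    proof (rule inj_onI)
      fix x y assume xy: "x \<in> W" "y \<in> W" "finv g (x 0) = finv g (y 0)"
      from injD[OF bij_is_inj[OF bij_imp_bij_inv[OF bij_g]] this(3)] have 0: "x 0 = y 0" .
      have "x = transl (x 0)" by (rule \<theta>_id_transl[OF W_id[OF xy(1)]])
      also have "\<dots> = y" unfolding 0 by (rule \<theta>_id_transl[OF W_id[OF xy(2)], symmetric])
      finally show "x = y" .
    qed
    show "(\<lambda>w. finv g (w 0)) ` W \<subseteq> {v. \<theta> b v = v}"
    proof (rule image_subsetI)
      fix w assume w: "w \<in> W"
      then have wB: "w \<in> B" by (simp add: W_def)
      have w0: "w = transl (w 0)" by (rule \<theta>_id_transl[OF W_id[OF w]])
      have "b (w 0) = w (b 0)" using fun_cong[OF comm[OF b wB], of 0] by simp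
      also have "w (b 0) = b 0 + w 0" using fun_cong[OF w0, of "b 0"] by (simp add: transl_def)
      finally have "lin b (w 0) = w 0" by (simp add: lin_def)
      then show "finv g (w 0) \<in> {v. \<theta> b v = v}"
        using bij_g by (simp add: \<theta>_def bij_is_surj surj_f_inv_f)
    qed
  qed simp
  have "B \<subseteq> transl_group"
  proof (rule ccontr)
    assume "\<not> B \<subseteq> transl_group"
    then obtain b where b: "b \<in> B" "b \<notin> transl_group" by blast
    have \<theta>b: "\<theta> b \<noteq> id"
    proof
      assume "\<theta> b = id"
      from \<theta>_id_transl[OF this] have "b \<in> transl_group" by (rule ssubst) (rule transl_in)
      then show False using b(2) by contradiction
    qed
    show False
    proof (cases "K \<subseteq> W")
      case True
      \<comment> \<open>In this case \<open>b\<close> has a nontrivial field automorphism. A fixed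
        vector of \<open>\<theta> b\<close> has its third coordinate among at most \<open>f\<close>
        values, so \<open>W\<close>, and hence \<open>K\<close>, has at most \<open>q^2 f\<close>
        elements.\<close>
      then have "b \<notin> K" using \<theta>b by (auto simp: W_def)
      then have twist_hom: "twist_hom (\<theta> b) \<noteq> id" using b(1) by (simp add: K_def)
      define f where "f = card {x. twist_hom (\<theta> b) x = x}"
      have "{v. \<theta> b v = v} \<subseteq> (\<lambda>(x, y, z). vec3 x y z) ` (UNIV \<times> UNIV \<times> {c. top_coord (\<theta> b) 1 * twist_hom (\<theta> b) c = c})"
      proof
        fix v assume "v \<in> {v. \<theta> b v = v}"
        then have "top_coord (\<theta> b) (v $ 3) = v $ 3" using norm_unips_nth_3[OF \<theta>_norm_unips[OF b(1)], of v] by simp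
        then have "top_coord (\<theta> b) 1 * twist_hom (\<theta> b) (v $ 3) = v $ 3"
          using top_coord_eq_twist_hom[OF \<theta>_norm_unips[OF b(1)], of "v $ 3"] by (simp add: mult.commute)
        then show "v \<in> (\<lambda>(x, y, z). vec3 x y z) ` (UNIV \<times> UNIV \<times> {c. top_coord (\<theta> b) 1 * twist_hom (\<theta> b) c = c})"
          by (intro image_eqI[of _ _ "(v $ 1, v $ 2, v $ 3)"]) simp_all
      qed
      then have "card {v. \<theta> b v = v} \<le> card ((\<lambda>(x, y, z). vec3 x y z) ` (UNIV \<times> UNIV \<times> {c. top_coord (\<theta> b) 1 * twist_hom (\<theta> b) c = c}))"
        by (intro card_mono) auto
      also have "\<dots> \<le> card ((UNIV :: 'a set) \<times> (UNIV :: 'a set) \<times> {c. top_coord (\<theta> b) 1 * twist_hom (\<theta> b) c = c})"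
        by (rule card_image_le) simp
      also have "\<dots> = CARD('a) * (CARD('a) * card {c. top_coord (\<theta> b) 1 * twist_hom (\<theta> b) c = c})"
        by (simp add: card_cartesian_product)
      also have "\<dots> \<le> CARD('a) * (CARD('a) * f)"
        unfolding f_def by (intro mult_le_mono2 card_twisted_fixed_field[OF field_hom_twist_hom[OF \<theta>_norm_unips[OF b(1)]]])
      finally have "card {v. \<theta> b v = v} \<le> CARD('a) * (CARD('a) * f)" .
      moreover have "card K \<le> card W" by (rule card_mono[OF _ True]) simp
      ultimately have "card K \<le> CARD('a) * (CARD('a) * f)" using W_fix[OF b(1)] by linarith
      then have "CARD('a) ^ 3 \<le> n * (CARD('a) * (CARD('a) * f))" using card by (meson le_trans mult_le_mono2)
      then have "(CARD('a) * CARD('a)) * CARD('a) \<le> (CARD('a) * CARD('a)) * (n * f)"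
        by (simp add: power3_eq_cube mult_ac)
      then have "CARD('a) \<le> n * f" by simp
      moreover have "f * f \<le> CARD('a)"
        unfolding f_def by (rule card_fixed_field[OF field_hom_twist_hom[OF \<theta>_norm_unips[OF b(1)]] twist_hom])
      ultimately show False by (rule no_small_square[rotated])
    next
      case False
      \<comment> \<open>In this case some conjugated linear part is a nontrivial element of
        \<open>U\<close>. It fixes at most \<open>q\<close> vectors, which bounds \<open>W\<close>
        by \<open>q\<close>, and the fibres of \<open>\<theta>\<close> over \<open>U\<close> then
        bound \<open>K\<close> by \<open>q^2\<close>.\<close>
      then obtain x where x: "x \<in> K" "x \<in> B" "\<theta> x \<noteq> id" by (auto simp: K_def W_def)
      obtain y where y: "\<theta> x = unip y" using K[OF x(1)] by (auto simp: unips_def)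
      then have "y \<noteq> 0" using x(3) by (auto simp: unip_0)
      have "{v. \<theta> x v = v} \<subseteq> (\<lambda>a. vec3 a 0 0) ` UNIV"
      proof
        fix v assume "v \<in> {v. \<theta> x v = v}"
        then have "v $ 2 = 0 \<and> v $ 3 = 0" using unip_fixed_iff[OF \<open>y \<noteq> 0\<close>, of v] by (simp add: y)
        then have "v = vec3 (v $ 1) 0 0" by (simp add: vec_eq_3)
        then show "v \<in> (\<lambda>a. vec3 a 0 0) ` UNIV" by (rule image_eqI) simp
      qed
      then have "card {v. \<theta> x v = v} \<le> card ((\<lambda>a. vec3 a 0 0) ` (UNIV :: 'a set))" by (intro card_mono) auto
      also have "\<dots> \<le> CARD('a)" by (rule card_image_le) simp
      finally have W: "card W \<le> CARD('a)" using W_fix[OF x(2)] by simp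
      have "card K \<le> CARD('a) * card W"
      proof (rule card_le_fibres[of K \<theta> unips])
        fix k assume k: "k \<in> K"
        then have kB: "k \<in> B" by (simp add: K_def)
        show "card {y \<in> K. \<theta> y = \<theta> k} \<le> card W"
        proof (rule card_inj_on_le[of "\<lambda>y. finv k \<circ> y"])
          show "inj_on (\<lambda>y. finv k \<circ> y) {y \<in> K. \<theta> y = \<theta> k}"
          proof (rule inj_onI)
            fix y z assume "finv k \<circ> y = finv k \<circ> z"
            then have "k \<circ> (finv k \<circ> y) = k \<circ> (finv k \<circ> z)" by simp
            then show "y = z" unfolding comp_cancel[OF Bd(2)[OF kB]] .
          qed
          show "(\<lambda>y. finv k \<circ> y) ` {y \<in> K. \<theta> y = \<theta> k} \<subseteq> W"
          proof (rule image_subsetI)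
            fix y assume "y \<in> {y \<in> K. \<theta> y = \<theta> k}"
            then have y: "y \<in> B" "\<theta> y = \<theta> k" by (simp_all add: K_def)
            have "\<theta> (finv k \<circ> y) = \<theta> (finv k \<circ> k)"
              unfolding \<theta>_comp[OF Bd(3)[OF kB] y(1)] \<theta>_comp[OF Bd(3)[OF kB] kB] y(2) ..
            then have "\<theta> (finv k \<circ> y) = id" by (simp only: bij_comp_inv[OF Bd(2)[OF kB]] \<theta>_id)
            then show "finv k \<circ> y \<in> W" using Bd(4)[OF Bd(3)[OF kB] y(1)] by (simp add: W_def)
          qed
        qed simp
      qed (use K card_unips in auto)
      also have "\<dots> \<le> CARD('a) * CARD('a)" by (rule mult_le_mono2[OF W])
      finally have "CARD('a) ^ 3 \<le> n * (CARD('a) * CARD('a))" using card by (meson le_trans mult_le_mono2)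
      then have "(CARD('a) * CARD('a)) * CARD('a) \<le> (CARD('a) * CARD('a)) * n"
        by (simp add: power3_eq_cube mult_ac)
      then have "CARD('a) \<le> n" by simp
      moreover have "n * 1 \<le> n * n" using n_pos by (intro mult_le_mono2)
      ultimately show False using n_n_less by linarith
    qed
  qed
  then show ?thesis by (rule card_subset_eq[rotated]) (simp_all only: B(3) card_transl_group card_vec3(2) finite)
qed

lemma conj_transl_group_unique:
  assumes g: "g \<in> design_auts D" and norm: "\<And>x. x \<in> conj_set g transl_group \<Longrightarrow> conj_set x transl_group = transl_group"
  shows "conj_set g transl_group = transl_group"
proof (rule abelian_normalizing_transl_group)
  have bij: "bij g" by (rule perm_groupD(2)[OF perm_group_design_auts g])
  show "perm_group (conj_set g transl_group)" by (rule perm_group_conj_set[OF perm_group_transl_group bij])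
  show "conj_set g transl_group \<subseteq> design_auts D"
    by (rule conj_set_subset[OF perm_group_design_auts g transl_group_subset_auts])
  show "card (conj_set g transl_group) = CARD('a) ^ 3"
    by (simp only: card_conj_set[OF bij] card_transl_group card_vec3(2))
  show "a \<circ> b = b \<circ> a" if "a \<in> conj_set g transl_group" "b \<in> conj_set g transl_group" for a b
    by (rule conj_set_commute[OF bij _ that]) (auto simp: transl_group_def transl_comp add.commute)
qed (rule norm)

end

section \<open>Isomorphisms of the designs\<close>

definition scale :: "'a \<Rightarrow> 'a::field ^ 3 \<Rightarrow> 'a ^ 3" where
  "scale s v = s *s v"

lemma additive_scale: "additive (scale s)"
  by (simp add: additive_def scale_def vec_eq_iff algebra_simps)

lemma scale_comp: "scale s \<circ> scale t = scale (s * t)"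
  by (simp add: fun_eq_iff scale_def)

lemma scale_1: "scale 1 = id"
  by (simp add: fun_eq_iff scale_def)

lemma bij_scale: "s \<noteq> 0 \<Longrightarrow> bij (scale s)"
  by (rule o_bij[of "scale (inverse s)"]) (simp_all add: scale_comp scale_1)

lemma scale_unip: "scale s \<circ> unip x = unip x \<circ> scale s"
  by (simp add: fun_eq_iff scale_def vec_eq_3 algebra_simps)

lemma A_maps_eq: "A_maps = {scale s \<circ> unip x | s x. s \<in> nonzero_squares}"
proof -
  have "(*v) (\<chi> i j. s * E_mat x $ i $ j) = scale s \<circ> unip x" for s x :: 'a
    by (simp add: fun_eq_iff vec_eq_iff scale_def unip_def matrix_vector_mult_def sum_distrib_left mult.assoc)
  then show ?thesis unfolding A_maps_def A_group_def by (auto simp: image_iff) (metis)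
qed

context odd_finite_field
begin

lemma scale_in_norm_unips:
  assumes "s \<noteq> 0"
  shows "scale s \<in> norm_unips"
proof -
  have "scale s \<circ> a \<circ> finv (scale s) = a" if "a \<in> unips" for a
  proof -
    from that obtain x where "a = unip x" by (auto simp: unips_def)
    then show ?thesis
      by (simp only: scale_unip comp_assoc bij_comp_inv[OF bij_scale[OF assms]] comp_id)
  qed
  then have "conj_set (scale s) unips = unips" unfolding conj_set_def by simp
  then show ?thesis by (simp add: norm_unips_def normalizes_def additive_scale bij_scale[OF assms])
qed

lemma twist_scale: "s \<noteq> 0 \<Longrightarrow> twist (scale s) x = x"
  by (rule twist_unique[OF bij_scale scale_unip])

lemma top_coord_scale: "top_coord (scale s) c = s * c"
  by (simp add: top_coord_def scale_def)

lemma twist_id: "twist id x = x"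
  using twist_unip[of 0 x] unfolding unip_0 .

lemma top_coord_id: "top_coord id c = c"
  by (simp add: top_coord_def)

end

context skew_design
begin

lemma scale_in_linear_auts:
  assumes s: "s \<in> nonzero_squares"
  shows "scale s \<in> linear_auts D"
proof (rule linear_autsI[OF additive_scale bij_scale[OF nonzero_squares_neq_0[OF s]]])
  show "scale s ` D = D"
  proof (intro equalityI subsetI)
    fix v assume v: "v \<in> D"
    have "v = scale s (scale (inverse s) v)"
      using nonzero_squares_neq_0[OF s] by (simp add: scale_def)
    moreover have "scale (inverse s) v \<in> D"
      unfolding scale_def by (rule scale_D[OF nonzero_squares_inverse[OF s] v])
    ultimately show "v \<in> scale s ` D" by (rule image_eqI)
  qed (use scale_D[OF s] in \<open>auto simp: scale_def\<close>)
qed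

text \<open>Conjugation by \<open>f\<close> keeps the trivial twist of \<open>scale s\<close> and
  turns its diagonal scalar into \<open>twist_hom f s\<close>, which is again a square. Dividing by
  that scalar, itself an automorphism of \<open>des D'\<close>, leaves an element covered by
  \<open>linear_aut_in_unips\<close>.\<close>

lemma conj_scale_in_A_maps:
  assumes D': "skew_design p n D'" and f: "f \<in> norm_unips" "maps_blocks f (des D) (des D')"
    and s: "s \<in> nonzero_squares"
  shows "\<exists>t b. t \<in> nonzero_squares \<and> f \<circ> scale s \<circ> finv f = scale t \<circ> unip b"
proof -
  interpret D': skew_design p n "TYPE('a)" D' by (rule D')
  note f' = norm_unipsD[OF f(1)] and Ug = perm_groupD[OF perm_group_norm_unips]
  define t where "t = twist_hom f s"
  have hom: "field_hom (twist_hom f)" by (rule field_hom_twist_hom[OF f(1)])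
  obtain r where "r \<noteq> 0" "s = r\<^sup>2" using s by (auto simp: nonzero_squares_def)
  then have t: "t \<in> nonzero_squares"
    unfolding nonzero_squares_def t_def
    by (intro CollectI exI[of _ "twist_hom f r"]) (simp add: field_homD(7)[OF hom] field_homD(9)[OF hom])
  have s0: "s \<noteq> 0" and t0: "t \<noteq> 0" using s t by (simp_all add: nonzero_squares_neq_0)
  define c where "c = f \<circ> scale s \<circ> finv f"
  have c_aut: "c \<in> linear_auts D'"
    using conj_set_linear_auts[OF f'(2) f(2) f'(1)] scale_in_linear_auts[OF s]
    unfolding c_def conj_set_def by (rule rev_subsetD[OF imageI, rotated])
  have c_norm_unips: "c \<in> norm_unips"
    unfolding c_def by (intro Ug(4) Ug(3) f(1) scale_in_norm_unips s0)
  have twist_c: "twist c x = x" for x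
  proof -
    have "twist c x = twist f (twist (finv f) x)"
      unfolding c_def by (simp only: twist_comp[OF Ug(4)[OF f(1) scale_in_norm_unips[OF s0]] Ug(3)[OF f(1)]]
          twist_comp[OF f(1) scale_in_norm_unips[OF s0]] twist_scale[OF s0])
    also have "\<dots> = twist (f \<circ> finv f) x" by (rule twist_comp[OF f(1) Ug(3)[OF f(1)], symmetric])
    finally show ?thesis by (simp only: bij_comp_inv[OF f'(2)] twist_id)
  qed
  have top_coord_c: "top_coord c 1 = t"
  proof -
    have "top_coord c 1 = top_coord f (s * top_coord (finv f) 1)"
      unfolding c_def by (simp only: top_coord_comp[OF Ug(4)[OF f(1) scale_in_norm_unips[OF s0]]] top_coord_comp[OF f(1)] top_coord_scale)
    \<comment> \<open>\<open>top_coord f\<close> is semilinear with respect to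
      \<open>twist_hom f\<close>, so the factor \<open>s\<close> comes out as
      \<open>t\<close>.\<close>
    also have "\<dots> = t * (twist_hom f (top_coord (finv f) 1) * top_coord f 1)"
      unfolding top_coord_eq_twist_hom[OF f(1), of "_ * _"] field_homD(3)[OF hom] t_def by simp
    also have "twist_hom f (top_coord (finv f) 1) * top_coord f 1 = top_coord (f \<circ> finv f) 1"
      unfolding top_coord_comp[OF f(1)] by (rule top_coord_eq_twist_hom[OF f(1), symmetric])
    finally show ?thesis by (simp only: bij_comp_inv[OF f'(2)] top_coord_id mult_1_right)
  qed
  define h where "h = scale (inverse t) \<circ> c"
  have it0: "inverse t \<noteq> 0" using t0 by simp
  have "h \<in> unips"
  proof (rule D'.linear_aut_in_unips)
    show "h \<in> linear_auts D'"
      unfolding h_def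
      by (rule perm_groupD(4)[OF perm_group_linear_auts D'.scale_in_linear_auts[OF nonzero_squares_inverse[OF t]] c_aut])
    show "h \<in> norm_unips" unfolding h_def by (rule Ug(4)[OF scale_in_norm_unips[OF it0] c_norm_unips])
    show "twist h x = x" for x
      unfolding h_def twist_comp[OF scale_in_norm_unips[OF it0] c_norm_unips] twist_scale[OF it0] by (rule twist_c)
    show "top_coord h 1 = 1"
      unfolding h_def top_coord_comp[OF scale_in_norm_unips[OF it0]] top_coord_scale top_coord_c using t0 by simp
  qed
  then obtain b where "h = unip b" by (auto simp: unips_def)
  moreover have "scale t \<circ> h = c"
    unfolding h_def comp_assoc[symmetric] scale_comp using t0 by (simp add: scale_1)
  ultimately show ?thesis using t unfolding c_def by metis
qed

text \<open>The map is corrected twice by automorphisms of \<open>des D'\<close>: first so that it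
  normalizes the translations, then, after passing to the linear part, so that it normalizes
  \<open>U\<close>. Each time a suitable conjugate of the transported group normalizes the original
  one and coincides with it, being abelian of the same order.\<close>

lemma isomorphism_normalizing_unips:
  assumes D': "skew_design p n D'" and f: "bij f" "maps_blocks f (des D) (des D')"
  shows "\<exists>g \<in> norm_unips. maps_blocks g (des D) (des D')"
proof -
  interpret D': skew_design p n "TYPE('a)" D' by (rule D')
  define G where "G = design_auts D'"
  note G = perm_groupD[OF perm_group_design_auts[of D'], folded G_def]
  define T where "T = (transl_group :: ('a ^ 3 \<Rightarrow> 'a ^ 3) set)"
  have T_abelian: "a \<circ> b = b \<circ> a" if "a \<in> T" "b \<in> T" for a b
    using that by (auto simp: T_def transl_group_def transl_comp add.commute)
  have cardT: "card T = p ^ (n * 3)"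
    unfolding T_def by (simp only: card_transl_group card_vec3(2) card_field power_mult)
  have X: "perm_group (conj_set f T)" "card (conj_set f T) = p ^ (n * 3)"
    using perm_group_conj_set[OF perm_group_transl_group f(1)] card_conj_set[OF f(1), of T] cardT
    by (simp_all add: T_def)
  have XG: "conj_set f T \<subseteq> G"
    using conj_set_mono[OF transl_group_subset_auts] conj_set_design_auts[OF f]
    unfolding T_def G_def by (rule subset_trans)
  have TG: "T \<subseteq> G" unfolding T_def G_def by (rule transl_group_subset_auts)
  \<comment> \<open>The \<open>p\<close>-group acting on the conjugates of \<open>T\<close> is the
    image of \<open>T\<close> under \<open>f\<close>, with \<open>\<theta>\<close> the
    identity.\<close>
  have "\<exists>g\<in>G. \<forall>x\<in>conj_set f T. conj_set (finv g \<circ> x \<circ> g) T = T"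
  proof (rule p_group_normalizes_conjugate[OF _ finite _ TG cardT prime_p _ X])
    show "perm_group G" unfolding G_def by (rule perm_group_design_auts)
    show "perm_group T" unfolding T_def by (rule perm_group_transl_group)
    show "conj_set g T = T" if "g \<in> G" "\<And>x. x \<in> conj_set g T \<Longrightarrow> conj_set x T = T" for g
      using that unfolding G_def T_def by (rule D'.conj_transl_group_unique)
    show "x \<in> G" if "x \<in> conj_set f T" for x using that XG by (rule rev_subsetD)
  qed simp_all
  then obtain g where g: "g \<in> G" and gX: "\<And>x. x \<in> conj_set f T \<Longrightarrow> conj_set (finv g \<circ> x \<circ> g) T = T"
    by blast
  have bij_g: "bij g" and ig: "finv g \<in> G" by (rule G(2)[OF g], rule G(3)[OF g])
  have bij_ig: "bij (finv g)" by (rule bij_imp_bij_inv[OF bij_g])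
  define f1 where "f1 = finv g \<circ> f"
  have bij_f1: "bij f1" unfolding f1_def by (rule bij_comp[OF f(1) bij_ig])
  have maps_f1: "maps_blocks f1 (des D) (des D')"
    unfolding f1_def using f(2) ig by (intro maps_blocks_comp) (auto simp: G_def design_auts_def)
  have f1T: "conj_set f1 T = T"
  proof -
    have eq: "conj_set f1 T = conj_set (finv g) (conj_set f T)"
      unfolding f1_def by (rule conj_set_comp[OF bij_ig f(1)])
    have "conj_set f1 T = transl_group"
    proof (rule D'.abelian_normalizing_transl_group)
      show "perm_group (conj_set f1 T)"
        unfolding T_def by (rule perm_group_conj_set[OF perm_group_transl_group bij_f1])
      show "conj_set f1 T \<subseteq> design_auts D'"
        using conj_set_mono[OF transl_group_subset_auts] conj_set_design_auts[OF bij_f1 maps_f1]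
        unfolding T_def by (rule subset_trans)
      show "card (conj_set f1 T) = CARD('a) ^ 3"
        unfolding card_conj_set[OF bij_f1] cardT card_field by (rule power_mult)
      show "a \<circ> b = b \<circ> a" if "a \<in> conj_set f1 T" "b \<in> conj_set f1 T" for a b
        by (rule conj_set_commute[OF bij_f1 T_abelian that])
      show "conj_set b transl_group = transl_group" if b: "b \<in> conj_set f1 T" for b
      proof -
        obtain x where "x \<in> conj_set f T" "b = finv g \<circ> x \<circ> g"
          using b unfolding eq conj_set_def[of "finv g"] inv_inv_eq[OF bij_g] by (elim imageE)
        then show ?thesis using gX[of x] by (simp only: T_def)
      qed
    qed
    then show ?thesis by (simp only: T_def)
  qed
  \<comment> \<open>Translations are automorphisms of \<open>des D'\<close>, so the constant term of
    the affine map \<open>f1\<close> can be removed.\<close>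
  define f2 where "f2 = lin f1"
  have bij_f2: "bij f2" unfolding f2_def by (rule bij_lin[OF bij_f1])
  have add_f2: "additive f2"
    unfolding f2_def by (rule additive_lin[OF bij_f1 f1T[unfolded T_def]])
  have maps_f2: "maps_blocks f2 (des D) (des D')"
  proof -
    have "transl (- f1 0) \<in> design_auts D'"
      by (rule subsetD[OF transl_group_subset_auts transl_in])
    then show ?thesis
      unfolding f2_def lin_eq using maps_f1 by (intro maps_blocks_comp) (auto simp: design_auts_def)
  qed
  define Y where "Y = conj_set f2 unips"
  have Y: "perm_group Y" "card Y = p ^ n"
    using perm_group_conj_set[OF perm_group_unips bij_f2] card_conj_set[OF bij_f2, of unips]
    by (simp_all add: Y_def card_unips card_field)
  have YL: "Y \<subseteq> linear_auts D'"
    using conj_set_mono[OF unips_subset_linear_auts] conj_set_linear_auts[OF bij_f2 maps_f2 add_f2]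
    unfolding Y_def by (rule subset_trans)
  \<comment> \<open>The same argument for \<open>U\<close>, now inside the additive automorphisms so
    that the corrected map stays additive.\<close>
  have "\<exists>g\<in>linear_auts D'. \<forall>x\<in>Y. conj_set (finv g \<circ> x \<circ> g) unips = unips"
    by (rule D'.normalizes_conj_unips[OF Y]) (use YL in auto)
  then obtain g2 where g2: "g2 \<in> linear_auts D'"
    and g2Y: "\<And>x. x \<in> Y \<Longrightarrow> conj_set (finv g2 \<circ> x \<circ> g2) unips = unips"
    by blast
  note L = perm_groupD[OF perm_group_linear_auts[of D']]
  have bij_g2: "bij g2" and ig2: "finv g2 \<in> linear_auts D'" by (rule L(2)[OF g2], rule L(3)[OF g2])
  have bij_ig2: "bij (finv g2)" by (rule bij_imp_bij_inv[OF bij_g2])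
  define f3 where "f3 = finv g2 \<circ> f2"
  have bij_f3: "bij f3" unfolding f3_def by (rule bij_comp[OF bij_f2 bij_ig2])
  have add_f3: "additive f3"
    unfolding f3_def by (rule additive_comp[OF linear_autsD(2)[OF ig2] add_f2])
  have maps_f3: "maps_blocks f3 (des D) (des D')"
    unfolding f3_def using maps_f2 linear_autsD(1)[OF ig2] by (intro maps_blocks_comp) (auto simp: design_auts_def)
  have "conj_set f3 unips = unips"
  proof (rule D'.abelian_normalizing_unips)
    have eq: "conj_set f3 unips = conj_set (finv g2) Y"
      unfolding f3_def Y_def by (rule conj_set_comp[OF bij_ig2 bij_f2])
    show "perm_group (conj_set f3 unips)"
      by (rule perm_group_conj_set[OF perm_group_unips bij_f3])
    show "conj_set f3 unips \<subseteq> linear_auts D'"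
      using conj_set_mono[OF unips_subset_linear_auts] conj_set_linear_auts[OF bij_f3 maps_f3 add_f3]
      by (rule subset_trans)
    show "card (conj_set f3 unips) = CARD('a)"
      unfolding card_conj_set[OF bij_f3] by (rule card_unips)
    show "a \<circ> b = b \<circ> a" if "a \<in> conj_set f3 unips" "b \<in> conj_set f3 unips" for a b
      by (rule conj_set_commute[OF bij_f3 _ that]) (auto simp: unips_def unip_add add.commute)
    show "conj_set b unips = unips" if b: "b \<in> conj_set f3 unips" for b
    proof -
      obtain x where "x \<in> Y" "b = finv g2 \<circ> x \<circ> g2"
        using b unfolding eq conj_set_def[of "finv g2"] inv_inv_eq[OF bij_g2] by (elim imageE)
      then show ?thesis using g2Y[of x] by (simp only:)
    qed
  qed
  then show ?thesis
    using bij_f3 add_f3 maps_f3 by (intro bexI[of _ f3]) (simp_all add: norm_unips_def normalizes_def)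
qed

text \<open>The conjugate has the same finite size, so one inclusion suffices; it is checked on the
  scalar and the unipotent factor separately.\<close>

lemma conj_A_maps:
  assumes D': "skew_design p n D'" and f: "f \<in> norm_unips" "maps_blocks f (des D) (des D')"
  shows "conj_set f A_maps = A_maps"
proof (rule card_subset_eq)
  interpret D': skew_design p n "TYPE('a)" D' by (rule D')
  show "finite (A_maps :: ('a ^ 3 \<Rightarrow> 'a ^ 3) set)" by simp
  show "card (conj_set f A_maps) = card (A_maps :: ('a ^ 3 \<Rightarrow> 'a ^ 3) set)"
    by (rule card_conj_set[OF norm_unipsD(2)[OF f(1)]])
  show "conj_set f A_maps \<subseteq> A_maps"
  proof
    fix h assume "h \<in> conj_set f A_maps"
    then obtain s x where s: "s \<in> nonzero_squares" and h: "h = f \<circ> (scale s \<circ> unip x) \<circ> finv f"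
      unfolding conj_set_def A_maps_eq by blast
    obtain t b where t: "t \<in> nonzero_squares" and c: "f \<circ> scale s \<circ> finv f = scale t \<circ> unip b"
      using conj_scale_in_A_maps[OF D' f s] by blast
    have "f \<circ> unip x \<circ> finv f = unip (twist f x)"
      unfolding twist_comm[OF f(1)] comp_assoc bij_comp_inv[OF norm_unipsD(2)[OF f(1)]] comp_id ..
    then have "h = scale t \<circ> unip b \<circ> unip (twist f x)"
      unfolding h conj_comp[OF norm_unipsD(2)[OF f(1)], symmetric] c by simp
    then have "h = scale t \<circ> unip (b + twist f x)" unfolding comp_assoc unip_add .
    then show "h \<in> A_maps" unfolding A_maps_eq using t by blast
  qed
qed

end

theorem theorem6p1:
  fixes p n :: nat
    and D D' :: "('a::finite_field ^ 3) set"
  assumes "prime p" and "[p = 3] (mod 4)" and "odd n"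
    and "CARD('a) = p ^ n"
    and "D \<in> DD" and "D' \<in> DD"
  shows "isomorphic_designs UNIV (des D) UNIV (des D') \<longleftrightarrow>
         (\<exists>g \<in> normalizer (AutoGroup additive_group) A_maps. maps_blocks g (des D) (des D'))"
proof
  \<comment> \<open>The residue 3 modulo 4 gives \<open>p \<ge> 3\<close>, and an odd
    \<open>n\<close> is positive.\<close>
  have "p mod 4 = 3" using assms(2) by (simp add: cong_def)
  then have "p \<ge> 3" by (metis mod_less_eq_dividend)
  then have field: "odd_finite_field TYPE('a) p n"
    using assms(1,3,4) by unfold_locales (auto elim: oddE)
  interpret D: skew_design p n "TYPE('a)" D
    using field assms(5) by (simp add: skew_design_def skew_design_axioms_def)
  have D': "skew_design p n D'"
    using field assms(6) by (simp add: skew_design_def skew_design_axioms_def)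
  assume "isomorphic_designs UNIV (des D) UNIV (des D')"
  then obtain f where f: "bij f" "maps_blocks f (des D) (des D')"
    by (auto simp: isomorphic_designs_def)
  obtain g where g: "g \<in> D.norm_unips" "maps_blocks g (des D) (des D')"
    using D.isomorphism_normalizing_unips[OF D' f] by blast
  have "g \<in> normalizer (AutoGroup additive_group) A_maps"
    using D.norm_unipsD[OF g(1)] D.conj_A_maps[OF D' g]
    by (simp add: normalizer_AutoGroup_additive[OF A_maps_subset_Aut] additive_def conj_set_def)
  then show "\<exists>g \<in> normalizer (AutoGroup additive_group) A_maps. maps_blocks g (des D) (des D')"
    using g(2) by blast
next
  assume "\<exists>g \<in> normalizer (AutoGroup additive_group) A_maps. maps_blocks g (des D) (des D')"
  \<comment> \<open>Elements of the normalizer are bijections of the point set.\<close>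
  then show "isomorphic_designs UNIV (des D) UNIV (des D')"
    unfolding normalizer_AutoGroup_additive[OF A_maps_subset_Aut] isomorphic_designs_def by blast
qed

end
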